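(* Let $n\in\mathbb{N}$, $0<\alpha<n$, $1<p<\infty$, $0<\rho<\infty$, and let $\omega$ be a weight on $\mathbb{R}^n$ with $\omega'=\omega^{-\frac{1}{p-1}}\in A_\infty^{\rm loc}$. There is a constant $C=C(n,\alpha,p,[\omega']_{A_{\infty;2\rho}^{\rm loc}})>0$, depending only on the indicated parameters, such that for every measurable $\varphi:\mathbb{R}^n\to[0,\infty]$, $$\int_0^\infty R_{\alpha,p;\rho}^{\omega}\left(\{x\in\mathbb{R}^n:(I_{\alpha,\rho}\ast\varphi)(x)>t\}\right)dt^p\le C\int_{\mathbb{R}^n}\varphi(x)^p\,\omega(x)\,dx .$$
   Context: $dt^p=p\,t^{p-1}dt$. $|x|_\infty=\max_i|x_i|$. Cubes are open with sides parallel to the axes; $\ell(Q)$ is the side length. A weight is a locally integrable function $\omega\ge0$ on $\mathbb{R}^n$ with $\omega>0$ a.e. $[\omega]_{A_{\infty;\rho}^{\rm loc}}=\sup_{\ell(Q)\le\rho}\left(\frac{1}{|Q|}\int_Q\omega\right)\exp\left(\frac{1}{|Q|}\int_Q\log\omega^{-1}\right)$; the class of weights for which this is finite does not depend on $0<\rho<\infty$ and is denoted $A_\infty^{\rm loc}$. $I_{\alpha,\rho}(x)=|x|_\infty^{\alpha-n}\chi_{\{|x|_\infty<\rho\}}$, and $R_{\alpha,p;\rho}^{\omega}(E)=\inf\left\{\int_{\mathbb{R}^n}f^p\omega\,dx:\ f\ge0\text{ measurable},\ f\in L^p(\omega),\ I_{\alpha,\rho}\ast f\ge1\text{ on }E\right\}$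 for $E\subseteq\mathbb{R}^n$ ($\inf\emptyset=\infty$). *)

theory Defs
  imports "HOL-Analysis.Analysis"
begin

text \<open>Only used for exponents \<open>p > 0\<close>.\<close>

definition ennpowr :: "ennreal \<Rightarrow> real \<Rightarrow> ennreal" where
  "ennpowr x p = (if x = \<infinity> then \<infinity> else ennreal (enn2real x powr p))"

definition weight :: "(real^'n \<Rightarrow> real) \<Rightarrow> bool" where
  "weight \<omega> \<longleftrightarrow> \<omega> \<in> borel_measurable lebesgue
     \<and> (\<forall>K. compact K \<longrightarrow> \<omega> absolutely_integrable_on K)
     \<and> (\<forall>x. 0 \<le> \<omega> x) \<and> (AE x in lebesgue. 0 < \<omega> x)"

text \<open>On the null set where \<open>\<omega>\<close> vanishes, \<open>powr\<close> returns 0 instead of \<open>\<infinity>\<close>; this affects no integral.\<close>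

definition dual_weight :: "real \<Rightarrow> (real^'n \<Rightarrow> real) \<Rightarrow> real^'n \<Rightarrow> real" where
  "dual_weight p \<omega> = (\<lambda>x. \<omega> x powr (- 1 / (p - 1)))"

definition cube :: "real^'n \<Rightarrow> real \<Rightarrow> (real^'n) set" where
  "cube a l = box a (\<chi> i. a $ i + l)"

text \<open>For a weight \<open>\<omega>\<close> the positive part of \<open>ln \<omega>\<close> is at most \<open>\<omega>\<close>, hence integrable over every cube,
  so \<open>ln (1/\<omega>)\<close> always has an integral in \<open>(-\<infinity>, \<infinity>]\<close>, which is \<open>\<infinity>\<close> exactly if \<open>ln (1/\<omega>)\<close> is
  not integrable. The exponential of the average is then \<open>\<infinity>\<close>.\<close>

definition exp_avg_ln_inverse :: "(real^'n \<Rightarrow> real) \<Rightarrow> (real^'n) set \<Rightarrow> ennreal" where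
  "exp_avg_ln_inverse \<omega> Q =
     (if set_integrable lebesgue Q (\<lambda>x. ln (inverse (\<omega> x)))
      then ennreal (exp ((LINT x:Q|lebesgue. ln (inverse (\<omega> x))) / measure lebesgue Q))
      else \<infinity>)"

definition A_infty_const :: "real \<Rightarrow> (real^'n \<Rightarrow> real) \<Rightarrow> ennreal" where
  "A_infty_const \<rho> \<omega> =
     (SUP Q \<in> {cube a l |a l. 0 < l \<and> l \<le> \<rho>}.
        ((\<integral>\<^sup>+x\<in>Q. ennreal (\<omega> x) \<partial>lebesgue) / emeasure lebesgue Q) * exp_avg_ln_inverse \<omega> Q)"

text \<open>Finiteness of the constant at one scale is equivalent to finiteness at all scales.\<close>

definition A_infty_loc :: "(real^'n \<Rightarrow> real) set" where
  "A_infty_loc = {\<omega>. weight \<omega> \<and> (\<exists>\<rho>>0. A_infty_const \<rho> \<omega> < \<infinity>)}"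

text \<open>\<open>infnorm\<close> is the maximum norm. The kernel takes the value 0 instead of \<open>\<infinity>\<close> at the origin,
  which does not affect convolutions.\<close>

definition riesz_kernel :: "real \<Rightarrow> real \<Rightarrow> real^'n \<Rightarrow> ennreal" where
  "riesz_kernel \<alpha> \<rho> x =
     ennreal (infnorm x powr (\<alpha> - real CARD('n))) * indicator {y. infnorm y < \<rho>} x"

definition riesz_potential :: "real \<Rightarrow> real \<Rightarrow> (real^'n \<Rightarrow> ennreal) \<Rightarrow> real^'n \<Rightarrow> ennreal" where
  "riesz_potential \<alpha> \<rho> f x = (\<integral>\<^sup>+y. riesz_kernel \<alpha> \<rho> (x - y) * f y \<partial>lebesgue)"

definition weighted_energy :: "real \<Rightarrow> (real^'n \<Rightarrow> real) \<Rightarrow> (real^'n \<Rightarrow> ennreal) \<Rightarrow> ennreal" where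
  "weighted_energy p \<omega> f = (\<integral>\<^sup>+x. ennpowr (f x) p * ennreal (\<omega> x) \<partial>lebesgue)"

definition riesz_capacity ::
    "real \<Rightarrow> real \<Rightarrow> real \<Rightarrow> (real^'n \<Rightarrow> real) \<Rightarrow> (real^'n) set \<Rightarrow> ennreal" where
  "riesz_capacity \<alpha> p \<rho> \<omega> E =
     (INF f \<in> {f \<in> borel_measurable lebesgue.
                 weighted_energy p \<omega> f < \<infinity> \<and> (\<forall>x\<in>E. 1 \<le> riesz_potential \<alpha> \<rho> f x)}.
        weighted_energy p \<omega> f)"

end

theory Submission
  imports Defs
begin

text \<open>Write \<open>\<sigma>\<close> for the dual weight. Up to constants, the truncated potential of \<open>\<phi>\<close> at \<open>x\<close> is at most
  \<open>V x = (\<Sum>Q\<ni>x. \<ell>(Q)\<^sup>\<alpha>\<^sup>-\<^sup>n \<integral>\<^bsub>3Q\<^esub> \<phi>)\<close>, the sum running over the dyadic cubes of side at most \<open>\<rho>\<close>.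
  Let \<open>G\<close> be the maximal function of the quotients \<open>(\<integral>\<^bsub>3Q\<^esub> \<phi>) / \<sigma>(Q)\<close>; since \<open>\<sigma>\<close> is doubling at scale \<open>\<rho>\<close>,
  \<open>\<integral> G\<^sup>p \<sigma>\<close> is bounded by \<open>\<integral> \<phi>\<^sup>p \<omega>\<close>. A multiple of \<open>\<sigma> G / V\<close> restricted to \<open>{V > t / 2}\<close> is an explicit
  competitor for the capacity of \<open>{V > t}\<close>: the Lebesgue average of \<open>V\<close> over \<open>Q\<close> is controlled by the
  partial sum \<open>V\<^sub>Q\<close> over the cubes containing \<open>Q\<close>, so \<open>V\<close> is at most a multiple of \<open>V\<^sub>Q\<close> on half of \<open>Q\<close>,
  and by the A-infinity condition that half carries a fixed fraction of \<open>\<sigma>(Q)\<close>; summing \<open>V\<^sub>Q\<close>-increments over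
  \<open>V\<^sub>Q\<close> then gives a potential of at least 1. As \<open>\<integral>\<^sub>0\<^sup>2\<^sup>V V\<^sup>-\<^sup>p dt\<^sup>p\<close> is constant, integrating the energies over the
  levels gives back \<open>\<integral> G\<^sup>p \<sigma>\<close>.\<close>

section \<open>Half-open cubes\<close>

declare emeasure_completion [simp del]

text \<open>Half-open cubes tile space exactly, so subdivisions and dyadic cells involve no
  exceptional null sets. They give the same integrals as the open cubes of
  \<open>cube\<close>.\<close>

definition hcube :: "real^'n \<Rightarrow> real \<Rightarrow> (real^'n) set" where
  "hcube a l = {y. \<forall>i. a $ i \<le> y $ i \<and> y $ i < a $ i + l}"

lemma cube_subset_hcube: "cube a l \<subseteq> hcube a l"
  by (auto simp: cube_def hcube_def mem_box_cart less_imp_le)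

lemma hcube_subset_cbox: "hcube a l \<subseteq> cbox a (\<chi> i. a $ i + l)"
  by (auto simp: hcube_def mem_box_cart less_imp_le)

lemma hcube_sets_borel: "hcube (a :: real^'n) l \<in> sets borel"
proof -
  have "hcube a l = (\<Inter>i. {y. a $ i \<le> y $ i} \<inter> {y. y $ i < a $ i + l})"
    by (auto simp: hcube_def)
  also have "\<dots> \<in> sets borel"
    by (intro sets.finite_INT sets.Int borel_closed borel_open closed_Collect_le open_Collect_less)
      (auto intro!: continuous_intros)
  finally show ?thesis .
qed

lemma hcube_sets [measurable, simp]: "hcube (a :: real^'n) l \<in> sets lebesgue"
  using hcube_sets_borel by (metis sets_completionI_sets sets_lborel)

lemma cube_sets [measurable, simp]: "cube (a :: real^'n) l \<in> sets lebesgue"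
  by (simp add: cube_def)

lemma emeasure_lebesgue_cbox_side:
  assumes "0 \<le> l"
  shows "emeasure lebesgue (cbox (a :: real^'n) (\<chi> i. a $ i + l)) = ennreal (l ^ CARD('n))"
proof -
  have "cbox a (\<chi> i. a $ i + l) \<noteq> {}"
    using assms by (auto simp: interval_ne_empty_cart)
  then have "measure lborel (cbox a (\<chi> i. a $ i + l)) = l ^ CARD('n)"
    by (simp add: content_cbox_cart)
  moreover have "emeasure lborel (cbox a (\<chi> i. a $ i + l)) = measure lborel (cbox a (\<chi> i. a $ i + l))"
    by (rule emeasure_eq_ennreal_measure) (use emeasure_lborel_cbox_finite in \<open>auto simp: less_top\<close>)
  ultimately show ?thesis
    by (simp add: emeasure_completion)
qed

text \<open>Both cubes lie between the open and the closed box with the same corners, and the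
  boundary of a box is negligible.\<close>

lemma AE_hcube_cube: "AE x in lebesgue. x \<in> hcube (a :: real^'n) l \<longleftrightarrow> x \<in> cube a l"
proof -
  let ?b = "\<chi> i. a $ i + l"
  have "cbox a ?b - box a ?b \<in> null_sets lebesgue"
    using negligible_frontier_interval negligible_iff_null_sets by blast
  then have "AE x in lebesgue. x \<notin> cbox a ?b - box a ?b"
    by (rule AE_not_in)
  then show ?thesis
    by eventually_elim (use cube_subset_hcube hcube_subset_cbox cube_def in \<open>blast\<close>)
qed

lemma emeasure_hcube:
  assumes "0 \<le> l"
  shows "emeasure lebesgue (hcube (a :: real^'n) l) = ennreal (l ^ CARD('n))"
proof (rule antisym)
  let ?b = "\<chi> i. a $ i + l"
  show "emeasure lebesgue (hcube a l) \<le> ennreal (l ^ CARD('n))"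
    unfolding emeasure_lebesgue_cbox_side[OF assms, of a, symmetric]
    by (rule emeasure_mono[OF hcube_subset_cbox]) simp
  have "AE x in lebesgue. x \<notin> cbox a ?b - box a ?b"
    by (rule AE_not_in) (use negligible_frontier_interval negligible_iff_null_sets in blast)
  then have "AE x in lebesgue. x \<in> cbox a ?b \<longrightarrow> x \<in> hcube a l"
    by eventually_elim (use cube_subset_hcube cube_def in blast)
  then show "ennreal (l ^ CARD('n)) \<le> emeasure lebesgue (hcube a l)"
    unfolding emeasure_lebesgue_cbox_side[OF assms, of a, symmetric]
    by (rule emeasure_mono_AE) simp
qed

lemma measure_hcube: "0 \<le> l \<Longrightarrow> measure lebesgue (hcube (a :: real^'n) l) = l ^ CARD('n)"
  by (simp add: measure_def emeasure_hcube)

lemma emeasure_cube: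
  "0 \<le> l \<Longrightarrow> emeasure lebesgue (cube (a :: real^'n) l) = ennreal (l ^ CARD('n))"
  using emeasure_eq_AE[OF AE_hcube_cube] emeasure_hcube by (metis cube_sets hcube_sets)

lemma measure_cube: "0 \<le> l \<Longrightarrow> measure lebesgue (cube (a :: real^'n) l) = l ^ CARD('n)"
  by (simp add: measure_def emeasure_cube)

lemma set_integral_cube_eq:
  fixes f :: "real^'n \<Rightarrow> real"
  assumes "f \<in> borel_measurable lebesgue"
  shows "set_integrable lebesgue (cube a l) f \<longleftrightarrow> set_integrable lebesgue (hcube a l) f"
    and "(LINT x:cube a l|lebesgue. f x) = (LINT x:hcube a l|lebesgue. f x)"
proof -
  have ae: "AE x in lebesgue. indicator (cube a l) x *\<^sub>R f x = indicator (hcube a l) x *\<^sub>R f x"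
    using AE_hcube_cube[of a l] by eventually_elim (auto simp: indicator_def)
  show "set_integrable lebesgue (cube a l) f \<longleftrightarrow> set_integrable lebesgue (hcube a l) f"
    unfolding set_integrable_def using assms ae by (intro integrable_cong_AE) auto
  show "(LINT x:cube a l|lebesgue. f x) = (LINT x:hcube a l|lebesgue. f x)"
    unfolding set_lebesgue_integral_def using assms ae by (intro integral_cong_AE) auto
qed

section \<open>Local A-infinity weights\<close>

lemma weight_measurable: "weight \<omega> \<Longrightarrow> \<omega> \<in> borel_measurable lebesgue"
  by (simp add: weight_def)

lemma weight_nonneg: "weight \<omega> \<Longrightarrow> 0 \<le> \<omega> x"
  by (simp add: weight_def)

lemma weight_set_integrable:
  assumes "weight \<omega>" "A \<in> sets lebesgue" "A \<subseteq> hcube a l"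
  shows "set_integrable lebesgue A \<omega>"
proof -
  have "set_integrable lebesgue (cbox a (\<chi> i. a $ i + l)) \<omega>"
    using assms(1) by (simp add: weight_def)
  then show ?thesis
    by (rule set_integrable_subset) (use assms hcube_subset_cbox in auto)
qed

lemma weight_integral_pos:
  assumes w: "weight \<omega>" and A: "A \<in> sets lebesgue" "A \<subseteq> hcube a l" "0 < measure lebesgue A"
  shows "0 < (LINT x:A|lebesgue. \<omega> x)"
proof -
  have int: "integrable lebesgue (\<lambda>x. indicator A x *\<^sub>R \<omega> x)"
    using weight_set_integrable[OF w A(1,2)] by (simp add: set_integrable_def)
  have nn: "0 \<le> indicator A x *\<^sub>R \<omega> x" for x
    using weight_nonneg[OF w] by auto
  have "(LINT x:A|lebesgue. \<omega> x) \<noteq> 0"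
  proof
    assume "(LINT x:A|lebesgue. \<omega> x) = 0"
    then have "AE x in lebesgue. indicator A x *\<^sub>R \<omega> x = 0"
      using integral_nonneg_eq_0_iff_AE[OF int] nn by (simp add: set_lebesgue_integral_def)
    moreover have "AE x in lebesgue. 0 < \<omega> x"
      using w by (simp add: weight_def)
    ultimately have "AE x in lebesgue. x \<notin> A"
      by eventually_elim (auto simp: indicator_def split: if_splits)
    then have "emeasure lebesgue A = 0"
      using A(1) by (subst (asm) AE_iff_measurable[OF A(1)]) auto
    then show False using A(3) by (simp add: measure_def)
  qed
  moreover have "0 \<le> (LINT x:A|lebesgue. \<omega> x)"
    unfolding set_lebesgue_integral_def by (rule Bochner_Integration.integral_nonneg) (use nn in auto)
  ultimately show ?thesis by linarith
qed

lemma weight_nn_integral: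
  assumes w: "weight \<omega>" and A: "A \<in> sets lebesgue" "A \<subseteq> hcube a l"
  shows "(\<integral>\<^sup>+x\<in>A. ennreal (\<omega> x) \<partial>lebesgue) = ennreal (LINT x:A|lebesgue. \<omega> x)"
proof -
  have "(\<integral>\<^sup>+x\<in>A. ennreal (\<omega> x) \<partial>lebesgue) = (\<integral>\<^sup>+x. ennreal (indicator A x *\<^sub>R \<omega> x) \<partial>lebesgue)"
    by (intro nn_integral_cong) (auto simp: indicator_def)
  also have "\<dots> = ennreal (LINT x:A|lebesgue. \<omega> x)"
    unfolding set_lebesgue_integral_def
    using weight_set_integrable[OF w A] weight_nonneg[OF w]
    by (intro nn_integral_eq_integral) (auto simp: set_integrable_def)
  finally show ?thesis .
qed

abbreviation avg_ln_inverse :: "(real^'n \<Rightarrow> real) \<Rightarrow> real^'n \<Rightarrow> real \<Rightarrow> real" where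
  "avg_ln_inverse \<omega> a l \<equiv> (LINT x:hcube a l|lebesgue. ln (inverse (\<omega> x))) / l ^ CARD('n)"

text \<open>A supremum of extended values over open cubes is traded for real inequalities on
  half-open cubes. Integrability of the logarithm belongs to the condition because otherwise the
  exponential of the average is infinite.\<close>

lemma A_infty_const_le_iff:
  fixes \<omega> :: "real^'n \<Rightarrow> real"
  assumes w: "weight \<omega>" and K: "0 \<le> K"
  shows "A_infty_const r \<omega> \<le> ennreal K \<longleftrightarrow>
    (\<forall>a l. 0 < l \<longrightarrow> l \<le> r \<longrightarrow> set_integrable lebesgue (hcube a l) (\<lambda>x. ln (inverse (\<omega> x))) \<and>
      (LINT x:hcube a l|lebesgue. \<omega> x) / l ^ CARD('n) * exp (avg_ln_inverse \<omega> a l) \<le> K)"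
proof -
  have [measurable]: "\<omega> \<in> borel_measurable lebesgue"
    using w by (rule weight_measurable)
  have m: "(\<lambda>x. ln (inverse (\<omega> x))) \<in> borel_measurable lebesgue" by measurable
  have "(\<integral>\<^sup>+x\<in>cube a l. ennreal (\<omega> x) \<partial>lebesgue) / emeasure lebesgue (cube a l)
          * exp_avg_ln_inverse \<omega> (cube a l) \<le> ennreal K \<longleftrightarrow>
        set_integrable lebesgue (hcube a l) (\<lambda>x. ln (inverse (\<omega> x))) \<and>
        (LINT x:hcube a l|lebesgue. \<omega> x) / l ^ CARD('n) * exp (avg_ln_inverse \<omega> a l) \<le> K"
    if l: "0 < l" for a l
  proof -
    \<comment> \<open>A positive average keeps an infinite exponential infinite in the product;
      \<open>0 * \<infinity>\<close> would be 0.\<close>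
    have pos: "0 < (LINT x:hcube a l|lebesgue. \<omega> x)"
      using l by (intro weight_integral_pos[OF w _ order_refl]) (auto simp: measure_hcube)
    have "(\<integral>\<^sup>+x\<in>cube a l. ennreal (\<omega> x) \<partial>lebesgue) / emeasure lebesgue (cube a l)
        = ennreal ((LINT x:hcube a l|lebesgue. \<omega> x) / l ^ CARD('n))"
      using l pos weight_nn_integral[OF w cube_sets cube_subset_hcube, of a l]
      by (simp add: emeasure_cube set_integral_cube_eq divide_ennreal)
    then show ?thesis
      using l pos K set_integral_cube_eq[OF m, of a l]
      by (auto simp: exp_avg_ln_inverse_def measure_cube ennreal_mult_top ennreal_mult''[symmetric] top_unique)
  qed
  note cube = this
  have "A_infty_const r \<omega> \<le> ennreal K \<longleftrightarrow> (\<forall>a l. 0 < l \<longrightarrow> l \<le> r \<longrightarrow>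
      (\<integral>\<^sup>+x\<in>cube a l. ennreal (\<omega> x) \<partial>lebesgue) / emeasure lebesgue (cube a l)
          * exp_avg_ln_inverse \<omega> (cube a l) \<le> ennreal K)"
    by (auto simp: A_infty_const_def SUP_le_iff)
  then show ?thesis
    using cube by simp
qed

section \<open>Weight carried by a large part of a cube\<close>

lemma set_integral_affine:
  fixes f :: "'a \<Rightarrow> real"
  assumes "set_integrable M E f" "E \<in> sets M" "emeasure M E < \<infinity>"
  shows "set_integrable M E (\<lambda>x. f x * c + d)"
    and "(LINT x:E|M. f x * c + d) = c * (LINT x:E|M. f x) + d * measure M E"
proof -
  have eq: "indicator E x *\<^sub>R (f x * c + d) = (indicator E x *\<^sub>R f x) * c + indicator E x * d" for x
    by (simp add: algebra_simps)
  have i: "integrable M (\<lambda>x. indicator E x *\<^sub>R f x)" "integrable M (indicator E :: _ \<Rightarrow> real)"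
    using assms by (auto simp: set_integrable_def)
  show "set_integrable M E (\<lambda>x. f x * c + d)"
    unfolding set_integrable_def eq using i by auto
  show "(LINT x:E|M. f x * c + d) = c * (LINT x:E|M. f x) + d * measure M E"
    unfolding set_lebesgue_integral_def eq using i assms
    by (subst Bochner_Integration.integral_add) (auto simp: Int_absorb2 sets.sets_into_space)
qed

text \<open>The factor \<open>exp 1 * K powr (1 / \<theta>)\<close> compares the average over the
  cube with the average over the part; the division by \<theta> turns averages back into
  integrals.\<close>

definition frac_const :: "real \<Rightarrow> real \<Rightarrow> real" where
  "frac_const K \<theta> = exp 1 * K powr (1 / \<theta>) / \<theta>"

text \<open>Instead of Jensen's inequality the proof uses \<open>ln x \<le> x / c - 1 + ln c\<close>, with \<open>c\<close> the
  average of the weight over \<open>F\<close>, respectively over the whole cube off \<open>F\<close>.\<close>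

lemma A_infty_fraction:
  fixes \<omega> :: "real^'n \<Rightarrow> real"
  assumes w: "weight \<omega>" and A: "A_infty_const r \<omega> \<le> ennreal K" and K: "1 \<le> K"
    and l: "0 < l" "l \<le> r" and F: "F \<in> sets lebesgue" "F \<subseteq> hcube a l"
    and th: "0 < \<theta>" "\<theta> * l ^ CARD('n) \<le> measure lebesgue F"
  shows "(LINT x:hcube a l|lebesgue. \<omega> x) \<le> frac_const K \<theta> * (LINT x:F|lebesgue. \<omega> x)"
proof -
  let ?Q = "hcube a l" and ?M = "measure lebesgue"
  define q where "q = l ^ CARD('n)"
  have q: "0 < q" "?M ?Q = q" using l by (auto simp: q_def measure_hcube)
  have fin: "emeasure lebesgue ?Q < \<infinity>" using l by (simp add: emeasure_hcube)
  have Fq: "0 < ?M F" "?M F \<le> q"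
    using th q(1) apply (smt (verit) mult_pos_pos q_def)
    using F fin q(2) by (metis fmeasurableI hcube_sets measure_mono_fmeasurable)
  have QF: "?M (?Q - F) = q - ?M F"
    using measure_Diff[of lebesgue ?Q F] F fin q(2) by (auto simp: less_top)
  let ?sQ = "LINT x:?Q|lebesgue. \<omega> x" and ?sF = "LINT x:F|lebesgue. \<omega> x"
    and ?sD = "LINT x:?Q - F|lebesgue. \<omega> x"
  have pos: "0 < ?sQ" "0 < ?sF"
    using weight_integral_pos[OF w hcube_sets order_refl] weight_integral_pos[OF w F] Fq q by auto
  have intF: "set_integrable lebesgue F \<omega>" and intD: "set_integrable lebesgue (?Q - F) \<omega>"
    by (rule weight_set_integrable[OF w]; use F in auto)+
  have split: "?sQ = ?sF + ?sD"
    using set_integral_Un[OF _ intF intD] F(2) by (simp add: Un_absorb1 Diff_disjoint)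
  define a' where "a' = ?sF / ?M F"
  define b where "b = ?sQ / q"
  have ab: "0 < a'" "0 < b" using pos Fq q by (auto simp: a'_def b_def)
  have intL: "set_integrable lebesgue ?Q (\<lambda>x. ln (inverse (\<omega> x)))"
    and le: "b * exp ((LINT x:?Q|lebesgue. ln (inverse (\<omega> x))) / q) \<le> K"
    using A l K unfolding A_infty_const_le_iff[OF w order_trans[OF zero_le_one K]] b_def q_def by auto
  have ae: "AE x in lebesgue. - ln (inverse (\<omega> x)) \<le> \<omega> x * inverse c + (ln c - 1)" if "0 < c" for c
  proof -
    have "AE x in lebesgue. 0 < \<omega> x" using w by (simp add: weight_def)
    then show ?thesis
    proof eventually_elim
      case (elim x)
      have "ln (\<omega> x / c) \<le> \<omega> x / c - 1"
        using elim that by (intro ln_le_minus_one) auto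
      then show ?case using elim that by (simp add: ln_div ln_inverse field_simps)
    qed
  qed
  have bound: "- (LINT x:E|lebesgue. ln (inverse (\<omega> x))) \<le>
      inverse c * (LINT x:E|lebesgue. \<omega> x) + (ln c - 1) * ?M E"
    if E: "E \<in> sets lebesgue" "E \<subseteq> ?Q" "0 < c" for E c
  proof -
    have fE: "emeasure lebesgue E < \<infinity>"
      using E fin emeasure_mono[of E ?Q lebesgue] by auto
    have iE: "set_integrable lebesgue E \<omega>"
      by (rule weight_set_integrable[OF w E(1,2)])
    have iL: "set_integrable lebesgue E (\<lambda>x. ln (inverse (\<omega> x)))"
      by (rule set_integrable_subset[OF intL]) (use E in auto)
    note aff = set_integral_affine[OF iE E(1) fE, of "inverse c" "ln c - 1"]
    have "- (LINT x:E|lebesgue. ln (inverse (\<omega> x))) = (LINT x:E|lebesgue. - ln (inverse (\<omega> x)))"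
      by (simp add: set_lebesgue_integral_def)
    also have "\<dots> \<le> (LINT x:E|lebesgue. \<omega> x * inverse c + (ln c - 1))"
      using aff(1) iL ae[OF \<open>0 < c\<close>] unfolding set_integrable_def set_lebesgue_integral_def
      by (intro integral_mono_AE) (auto simp: indicator_def)
    finally show ?thesis using aff(2) by simp
  qed
  have "(LINT x:?Q|lebesgue. ln (inverse (\<omega> x))) =
      (LINT x:F|lebesgue. ln (inverse (\<omega> x))) + (LINT x:?Q - F|lebesgue. ln (inverse (\<omega> x)))"
    using set_integral_Un[of F "?Q - F" lebesgue "\<lambda>x. ln (inverse (\<omega> x))"]
      set_integrable_subset[OF intL] F by (auto simp: Un_absorb1)
  then have "- (LINT x:?Q|lebesgue. ln (inverse (\<omega> x))) \<le>
      inverse a' * ?sF + (ln a' - 1) * ?M F + (inverse b * ?sD + (ln b - 1) * ?M (?Q - F))"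
    using bound[of F a'] bound[of "?Q - F" b] F ab by auto
  also have "inverse a' * ?sF = ?M F"
    using pos Fq by (simp add: a'_def)
  also have "inverse b * ?sD \<le> inverse b * ?sQ"
    using ab pos split by (intro mult_left_mono) auto
  also have "inverse b * ?sQ = q"
    using pos q by (simp add: b_def)
  \<comment> \<open>On \<open>F\<close> the linear terms cancel. Off \<open>F\<close> they leave
    \<open>q\<close> minus the measure of \<open>?Q - F\<close>, that is, the measure of
    \<open>F\<close>; this is the summand 1 and later the factor \<open>exp 1\<close>.\<close>
  finally have 1: "- (LINT x:?Q|lebesgue. ln (inverse (\<omega> x))) \<le> ?M F * (ln a' + 1 - ln b) + q * ln b"
    unfolding QF by (simp add: algebra_simps)
  have "ln (b * exp ((LINT x:?Q|lebesgue. ln (inverse (\<omega> x))) / q)) \<le> ln K"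
    using le ab by (intro ln_mono) auto
  then have "ln b + (LINT x:?Q|lebesgue. ln (inverse (\<omega> x))) / q \<le> ln K"
    using ab by (simp add: ln_mult)
  then have "q * ln b + (LINT x:?Q|lebesgue. ln (inverse (\<omega> x))) \<le> q * ln K"
    using q by (simp add: field_simps)
  with 1 have "?M F * (ln b - ln a' - 1) \<le> q * ln K"
    by (simp add: algebra_simps)
  then have "ln b - ln a' - 1 \<le> q * ln K / ?M F"
    using Fq by (simp add: field_simps)
  \<comment> \<open>The numerator is nonnegative because \<open>1 \<le> K\<close>, so the smaller
    denominator gives an upper bound; the exponent \<open>1 / \<theta>\<close> comes from
    here.\<close>
  also have "\<dots> \<le> q * ln K / (\<theta> * q)"
    using th q K Fq by (intro divide_left_mono mult_nonneg_nonneg) (auto simp: q_def)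
  also have "\<dots> = ln (K powr (1 / \<theta>))"
    using q K by (simp add: ln_powr)
  finally have "ln b \<le> ln (a' * (exp 1 * K powr (1 / \<theta>)))"
    using ab K by (simp add: ln_mult)
  then have "b \<le> a' * (exp 1 * K powr (1 / \<theta>))"
    using ab K by (subst (asm) ln_le_cancel_iff) auto
  then have "?sQ \<le> ?sF * (exp 1 * K powr (1 / \<theta>)) * (q / ?M F)"
    using q Fq by (simp add: a'_def b_def field_simps)
  also have "\<dots> \<le> ?sF * (exp 1 * K powr (1 / \<theta>)) * (q / (\<theta> * q))"
    using th q Fq pos by (intro mult_left_mono divide_left_mono) (auto simp: q_def)
  also have "\<dots> = frac_const K \<theta> * ?sF"
    using q by (simp add: frac_const_def)
  finally show ?thesis .
qed

section \<open>Change of scale in the A-infinity condition\<close>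

lemma weight_integral_mono:
  assumes w: "weight \<omega>" and "A \<in> sets lebesgue" "B \<in> sets lebesgue" "A \<subseteq> B" "B \<subseteq> hcube a l"
  shows "(LINT x:A|lebesgue. \<omega> x) \<le> (LINT x:B|lebesgue. \<omega> x)"
  unfolding set_lebesgue_integral_def
proof (rule integral_mono)
  show "integrable lebesgue (\<lambda>x. indicator A x *\<^sub>R \<omega> x)" "integrable lebesgue (\<lambda>x. indicator B x *\<^sub>R \<omega> x)"
    using weight_set_integrable[OF w, of A a l] weight_set_integrable[OF w, of B a l] assms
    by (auto simp: set_integrable_def)
  show "indicator A x *\<^sub>R \<omega> x \<le> indicator B x *\<^sub>R \<omega> x" for x
    using assms weight_nonneg[OF w] by (auto simp: indicator_def)
qed

text \<open>The Boolean vector \<open>b\<close> tells in which coordinates the upper half is taken.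
  Half-open intervals make this an exact partition.\<close>

lemma hcube_halves:
  fixes a :: "real^'n"
  assumes "0 < h"
  defines "Q \<equiv> \<lambda>b :: 'n \<Rightarrow> bool. hcube (\<chi> i. a $ i + (if b i then h else 0)) h"
  shows "(\<Union>b. Q b) = hcube a (2 * h)" "disjoint_family Q"
proof -
  show "(\<Union>b. Q b) = hcube a (2 * h)"
  proof (intro equalityI subsetI)
    fix y assume "y \<in> hcube a (2 * h)"
    then have "\<forall>i. a $ i \<le> y $ i \<and> y $ i < a $ i + 2 * h"
      by (simp add: hcube_def)
    then have "\<forall>i. a $ i + (if a $ i + h \<le> y $ i then h else 0) \<le> y $ i \<and>
        y $ i < a $ i + (if a $ i + h \<le> y $ i then h else 0) + h"
      by (smt (verit, best))
    then have "y \<in> Q (\<lambda>i. a $ i + h \<le> y $ i)"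
      by (simp add: Q_def hcube_def)
    then show "y \<in> (\<Union>b. Q b)" by blast
  next
    fix y assume "y \<in> (\<Union>b. Q b)"
    then obtain b where b: "\<And>i. a $ i + (if b i then h else 0) \<le> y $ i \<and> y $ i < a $ i + (if b i then h else 0) + h"
      by (auto simp: Q_def hcube_def)
    have "a $ i \<le> y $ i \<and> y $ i < a $ i + 2 * h" for i
      using b[of i] assms(1) by (cases "b i") auto
    then show "y \<in> hcube a (2 * h)" by (simp add: hcube_def)
  qed
  have "b = c" if "y \<in> Q b" "y \<in> Q c" for y b c
  proof
    fix i
    have "a $ i + (if b i then h else 0) \<le> y $ i \<and> y $ i < a $ i + (if b i then h else 0) + h"
      "a $ i + (if c i then h else 0) \<le> y $ i \<and> y $ i < a $ i + (if c i then h else 0) + h"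
      using that by (auto simp: Q_def hcube_def)
    then show "b i = c i" by (cases "b i"; cases "c i") auto
  qed
  then show "disjoint_family Q"
    unfolding disjoint_family_on_def by blast
qed

text \<open>Any two of the \<open>2 ^ n\<close> half-size subcubes of a cube are compared through
  the half-size cube with the same centre, which meets each of them in a cube of a quarter of the size.\<close>

lemma A_infty_const_double:
  fixes \<omega> :: "real^'n \<Rightarrow> real"
  assumes w: "weight \<omega>" and A: "A_infty_const r \<omega> < \<infinity>"
  shows "A_infty_const (2 * r) \<omega> < \<infinity>"
proof -
  obtain K0 where "0 \<le> K0" "A_infty_const r \<omega> = ennreal K0"
    using A by (cases "A_infty_const r \<omega>") auto
  then have AK: "A_infty_const r \<omega> \<le> ennreal (max 1 K0)" and K: "1 \<le> max 1 K0"
    by (auto intro: ennreal_leI)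
  define K where "K = max 1 K0"
  define B where "B = frac_const K ((1/2) ^ CARD('n))"
  have B: "0 < B" using K by (auto simp: B_def frac_const_def K_def)
  have "A_infty_const (2 * r) \<omega> \<le> ennreal (K * B\<^sup>2)"
    unfolding A_infty_const_le_iff[OF w mult_nonneg_nonneg[OF order_trans[OF zero_le_one K] zero_le_power2], folded K_def]
  proof (intro allI impI)
    fix a :: "real^'n" and l :: real
    assume l: "0 < l" "l \<le> 2 * r"
    define h where "h = l / 2"
    have h: "0 < h" "h \<le> r" "l = 2 * h" using l by (auto simp: h_def)
    define Q where "Q b = hcube (\<chi> i. a $ i + (if b i then h else 0)) h" for b :: "'n \<Rightarrow> bool"
    \<comment> \<open>This is the intersection of \<open>Q b\<close> with \<open>C\<close>. Its
      volume is the fraction \<open>(1/2) ^ CARD('n)\<close> of either, which is the fraction used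
      in \<open>B\<close>.\<close>
    define S where "S b = hcube (\<chi> i. a $ i + (if b i then h else h / 2)) (h / 2)" for b :: "'n \<Rightarrow> bool"
    define C where "C = hcube (\<chi> i. a $ i + h / 2) h"
    have un: "(\<Union>b. Q b) = hcube a l" and dis: "disjoint_family Q"
      using hcube_halves[OF h(1), of a] by (simp_all only: Q_def[abs_def] h(3))
    have SQ: "S b \<subseteq> Q b" and SC: "S b \<subseteq> C" for b
    proof -
      have "(y $ i \<ge> a $ i + (if b i then h else 0) \<and> y $ i < a $ i + (if b i then h else 0) + h) \<and>
          a $ i + h / 2 \<le> y $ i \<and> y $ i < a $ i + h / 2 + h" if "y \<in> S b" for y i
      proof -
        have "a $ i + (if b i then h else h / 2) \<le> y $ i \<and> y $ i < a $ i + (if b i then h else h / 2) + h / 2"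
          using that by (auto simp: S_def hcube_def)
        then show ?thesis using h(1) by (cases "b i") auto
      qed
      then show "S b \<subseteq> Q b" "S b \<subseteq> C"
        unfolding Q_def C_def hcube_def subset_iff mem_Collect_eq vec_lambda_beta by blast+
    qed
    let ?s = "\<lambda>E. LINT x:E|lebesgue. \<omega> x" and ?L = "\<lambda>E. LINT x:E|lebesgue. ln (inverse (\<omega> x))"
    have frac: "?s (hcube c h) \<le> B * ?s (S b)" if "S b \<subseteq> hcube c h" for b c
      unfolding B_def
      by (rule A_infty_fraction[OF w AK[folded K_def] K[folded K_def] h(1,2) _ that])
        (use h in \<open>auto simp: S_def measure_hcube power_divide\<close>)
    have Qpos: "0 < ?s (Q b)" for b
      unfolding Q_def using h by (intro weight_integral_pos[OF w _ order_refl]) (auto simp: measure_hcube)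
    have comp: "?s (Q c) \<le> B\<^sup>2 * ?s (Q b)" for b c
    proof -
      have "?s (Q c) \<le> B * ?s (S c)"
        unfolding Q_def by (rule frac) (use SQ Q_def in auto)
      also have "?s (S c) \<le> ?s C"
        unfolding C_def by (rule weight_integral_mono[OF w _ _ _ order_refl]) (use SC C_def S_def in auto)
      also have "?s C \<le> B * ?s (S b)"
        unfolding C_def by (rule frac) (use SC C_def in auto)
      also have "?s (S b) \<le> ?s (Q b)"
        unfolding Q_def by (rule weight_integral_mono[OF w _ _ _ order_refl]) (use SQ Q_def S_def in auto)
      finally show ?thesis using B by (simp add: power2_eq_square mult.assoc)
    qed
    have intQ: "set_integrable lebesgue (Q b) (\<lambda>x. ln (inverse (\<omega> x)))"
      and leQ: "?s (Q b) / h ^ CARD('n) * exp (?L (Q b) / h ^ CARD('n)) \<le> K" for b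
      using AK[folded K_def] h unfolding A_infty_const_le_iff[OF w order_trans[OF zero_le_one K], folded K_def] Q_def
      by auto
    have Qsets: "Q b \<in> sets lebesgue" and Qsub: "Q b \<subseteq> hcube (\<chi> i. a $ i + (if b i then h else 0)) h" for b
      by (auto simp: Q_def)
    have int: "set_integrable lebesgue (hcube a l) (\<lambda>x. ln (inverse (\<omega> x)))"
      unfolding un[symmetric] using intQ by (intro set_integrable_UN) (auto simp: Qsets)
    have Lsum: "?L (hcube a l) = (\<Sum>b\<in>UNIV. ?L (Q b))"
      unfolding un[symmetric] using intQ dis by (intro set_integral_finite_Union) (auto simp: Qsets)
    have "?s (hcube a l) = (\<Sum>b\<in>UNIV. ?s (Q b))"
      unfolding un[symmetric] using dis weight_set_integrable[OF w Qsets Qsub]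
      by (intro set_integral_finite_Union) (auto simp: Qsets)
    also have "\<dots> \<le> (\<Sum>c\<in>(UNIV :: ('n \<Rightarrow> bool) set). B\<^sup>2 * ?s (Q b))" for b
      by (intro sum_mono comp)
    finally have tot: "?s (hcube a l) \<le> 2 ^ CARD('n) * B\<^sup>2 * ?s (Q b)" for b
      by (simp add: card_fun mult.assoc)
    have pos: "0 < ?s (hcube a l)"
      using l by (intro weight_integral_pos[OF w _ order_refl]) (auto simp: measure_hcube)
    \<comment> \<open>This is the largest value of the exponential average over the large cube that
      keeps the product below \<open>K * B\<^sup>2\<close>. Each half-size cube obeys the same
      bound, as its mass is comparable to the total by \<open>tot\<close>, and the average of the
      logarithm over the large cube is the mean of the averages over the halves.\<close>
    let ?T = "K * B\<^sup>2 * l ^ CARD('n) / ?s (hcube a l)"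
    have Kpos: "0 < K" using K by (simp add: K_def)
    have T: "0 < ?T" using Kpos B l pos by simp
    have "?L (Q b) \<le> h ^ CARD('n) * ln ?T" for b
    proof -
      have "exp (?L (Q b) / h ^ CARD('n)) \<le> K * h ^ CARD('n) / ?s (Q b)"
        using leQ[of b] Qpos[of b] h by (simp add: field_simps)
      also have "\<dots> \<le> ?T"
      proof -
        have "K * h ^ CARD('n) * ?s (hcube a l) \<le> K * h ^ CARD('n) * (2 ^ CARD('n) * B\<^sup>2 * ?s (Q b))"
          using tot[of b] Kpos h by (intro mult_left_mono) auto
        then show ?thesis
          using Qpos[of b] pos by (simp add: field_simps h(3) power_mult_distrib)
      qed
      finally have "?L (Q b) / h ^ CARD('n) \<le> ln ?T"
        using T by (subst ln_ge_iff) auto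
      then show ?thesis using h by (simp add: field_simps)
    qed
    then have "?L (hcube a l) \<le> (\<Sum>b\<in>(UNIV :: ('n \<Rightarrow> bool) set). h ^ CARD('n) * ln ?T)"
      unfolding Lsum by (intro sum_mono)
    also have "\<dots> = l ^ CARD('n) * ln ?T"
      by (simp add: card_fun h(3) power_mult_distrib)
    finally have "exp (avg_ln_inverse \<omega> a l) \<le> exp (ln ?T)"
      using l by (subst exp_le_cancel_iff) (simp add: field_simps)
    also have "\<dots> = ?T" using T by simp
    finally have "?s (hcube a l) / l ^ CARD('n) * exp (avg_ln_inverse \<omega> a l)
        \<le> ?s (hcube a l) / l ^ CARD('n) * ?T"
      using pos l by (intro mult_left_mono) auto
    also have "\<dots> = K * B\<^sup>2" using pos l by simp
    finally show "set_integrable lebesgue (hcube a l) (\<lambda>x. ln (inverse (\<omega> x))) \<and>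
        ?s (hcube a l) / l ^ CARD('n) * exp (avg_ln_inverse \<omega> a l) \<le> K * B\<^sup>2"
      using int by simp
  qed
  then show ?thesis
    by (rule order.strict_trans1) simp
qed

lemma A_infty_const_mono:
  assumes "r \<le> s"
  shows "A_infty_const r \<omega> \<le> A_infty_const s \<omega>"
  unfolding A_infty_const_def
proof (rule SUP_subset_mono)
  show "{cube a l |a l. 0 < l \<and> l \<le> r} \<subseteq> {cube a l |a l. 0 < l \<and> l \<le> s}"
  proof
    fix Q assume "Q \<in> {cube a l |a l. 0 < l \<and> l \<le> r}"
    then obtain a l where "Q = cube a l" "0 < l" "l \<le> s"
      using assms by force
    then show "Q \<in> {cube a l |a l. 0 < l \<and> l \<le> s}" by blast
  qed
qed simp

text \<open>Membership in the class gives finiteness at some unspecified scale, while the estimate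
  uses the scale twice the truncation radius. Repeated doubling of the scale passes every
  radius.\<close>

lemma A_infty_const_finite:
  assumes "\<omega> \<in> A_infty_loc"
  shows "A_infty_const r \<omega> < \<infinity>"
proof -
  obtain s where w: "weight \<omega>" and s: "0 < s" "A_infty_const s \<omega> < \<infinity>"
    using assms by (auto simp: A_infty_loc_def)
  have fin: "A_infty_const (2 ^ k * s) \<omega> < \<infinity>" for k
    by (induction k) (use A_infty_const_double[OF w] s in \<open>auto simp: mult.assoc\<close>)
  obtain k where "r / s < 2 ^ k" using real_arch_pow[of 2] by auto
  then have "r \<le> 2 ^ k * s" using s by (simp add: field_simps)
  then show ?thesis using fin[of k] A_infty_const_mono le_less_trans by blast
qed

section \<open>Dyadic cells\<close>

definition side :: "real \<Rightarrow> nat \<Rightarrow> real" where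
  "side \<rho> k = \<rho> / 2 ^ k"

text \<open>Addressing dyadic cells by integer vectors turns nesting into integer division by 2 and
  adjacency into a bound on differences of integers. Larger \<open>k\<close> means smaller
  cells.\<close>

definition idx :: "real \<Rightarrow> nat \<Rightarrow> real^'n \<Rightarrow> 'n \<Rightarrow> int" where
  "idx \<rho> k y = (\<lambda>i. \<lfloor>y $ i / side \<rho> k\<rfloor>)"

definition near :: "('n \<Rightarrow> int) \<Rightarrow> ('n \<Rightarrow> int) \<Rightarrow> bool" where
  "near i j \<longleftrightarrow> (\<forall>c. \<bar>i c - j c\<bar> \<le> 1)"

definition cell :: "real \<Rightarrow> nat \<Rightarrow> ('n \<Rightarrow> int) \<Rightarrow> (real^'n) set" where
  "cell \<rho> k j = {y. idx \<rho> k y = j}"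

text \<open>This is the concentric cube of three times the side, the \<open>3Q\<close> of the
  overview, presented as a union of cells.\<close>

definition nbhd :: "real \<Rightarrow> nat \<Rightarrow> ('n \<Rightarrow> int) \<Rightarrow> (real^'n) set" where
  "nbhd \<rho> k j = {y. near (idx \<rho> k y) j}"

lemma near_refl [simp]: "near i i"
  by (simp add: near_def)

lemma near_sym: "near i j \<longleftrightarrow> near j i"
  by (auto simp: near_def abs_minus_commute)

lemma finite_near: "finite {i :: 'n::finite \<Rightarrow> int. near i j}"
  and card_near: "card {i :: 'n::finite \<Rightarrow> int. near i j} = 3 ^ CARD('n)"
proof -
  have eq: "{i. near i j} = PiE UNIV (\<lambda>c. {j c - 1 .. j c + 1})"
    by (auto simp: near_def PiE_def Pi_def abs_diff_le_iff algebra_simps)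
  show "finite {i. near i j}" unfolding eq by (intro finite_PiE) auto
  show "card {i. near i j} = 3 ^ CARD('n)" unfolding eq by (subst card_PiE) auto
qed

lemma side_pos: "0 < \<rho> \<Longrightarrow> 0 < side \<rho> k"
  by (simp add: side_def)

lemma side_le: "0 < \<rho> \<Longrightarrow> side \<rho> k \<le> \<rho>"
  by (simp add: side_def field_simps)

lemma cell_eq_hcube:
  assumes "0 < \<rho>"
  shows "cell \<rho> k j = hcube (\<chi> i. of_int (j i) * side \<rho> k) (side \<rho> k)"
  using side_pos[OF assms, of k]
  by (auto simp: cell_def idx_def hcube_def fun_eq_iff floor_eq_iff field_simps)

lemma nbhd_eq_hcube:
  assumes "0 < \<rho>"
  shows "nbhd \<rho> k j = hcube (\<chi> i. of_int (j i - 1) * side \<rho> k) (3 * side \<rho> k)"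
proof -
  have "\<bar>\<lfloor>t / side \<rho> k\<rfloor> - c\<bar> \<le> 1 \<longleftrightarrow>
      of_int (c - 1) * side \<rho> k \<le> t \<and> t < of_int (c - 1) * side \<rho> k + 3 * side \<rho> k" for t c
  proof -
    have "\<bar>\<lfloor>t / side \<rho> k\<rfloor> - c\<bar> \<le> 1 \<longleftrightarrow> c - 1 \<le> \<lfloor>t / side \<rho> k\<rfloor> \<and> \<lfloor>t / side \<rho> k\<rfloor> < c + 2"
      by auto
    also have "\<dots> \<longleftrightarrow> of_int (c - 1) \<le> t / side \<rho> k \<and> t / side \<rho> k < of_int (c + 2)"
      by (simp only: le_floor_iff floor_less_iff)
    also have "\<dots> \<longleftrightarrow> of_int (c - 1) * side \<rho> k \<le> t \<and> t < of_int (c - 1) * side \<rho> k + 3 * side \<rho> k"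
      using side_pos[OF assms, of k]
      by (simp add: pos_le_divide_eq pos_divide_less_eq del: of_int_add of_int_diff)
        (simp add: algebra_simps)
    finally show ?thesis .
  qed
  then show ?thesis
    by (auto simp: nbhd_def near_def idx_def hcube_def)
qed

lemma nbhd_eq_UN: "nbhd \<rho> k j = (\<Union>i\<in>{i. near i j}. cell \<rho> k i)"
  by (auto simp: nbhd_def cell_def)

lemma idx_div: "idx \<rho> k y i = idx \<rho> (Suc k) y i div 2"
proof -
  have "y $ i / side \<rho> k = y $ i / side \<rho> (Suc k) / real_of_int 2"
    by (simp add: side_def)
  then show ?thesis
    unfolding idx_def by (simp only: floor_divide_real_eq_div)
qed

lemma abs_div_2_diff_le: "\<bar>a - b\<bar> \<le> 1 \<Longrightarrow> \<bar>a div 2 - b div 2\<bar> \<le> (1 :: int)"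
  by linarith

text \<open>Passing to the parent cell halves the index, and integer division by 2 never turns a
  difference of at most 1 into a larger one.\<close>

lemma near_le:
  assumes "k \<le> m" "near (idx \<rho> m x) (idx \<rho> m y)"
  shows "near (idx \<rho> k x) (idx \<rho> k y)"
  using assms
proof (induction rule: inc_induct)
  case (step k)
  then have "near (idx \<rho> (Suc k) x) (idx \<rho> (Suc k) y)" by blast
  then show ?case
    unfolding near_def idx_div[of \<rho> k] using abs_div_2_diff_le by blast
qed simp

lemma idx_eq_le:
  assumes "k \<le> m" "idx \<rho> m x = idx \<rho> m y"
  shows "idx \<rho> k x = idx \<rho> k y"
  using assms
proof (induction rule: inc_induct)
  case (step k)
  then have "idx \<rho> (Suc k) x = idx \<rho> (Suc k) y" by blast
  then show ?case by (simp add: fun_eq_iff idx_div[of \<rho> k x] idx_div[of \<rho> k y])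
qed simp

lemma cell_sets [measurable, simp]: "0 < \<rho> \<Longrightarrow> cell \<rho> k j \<in> sets lebesgue"
  by (simp add: cell_eq_hcube)

lemma nbhd_sets [measurable, simp]: "0 < \<rho> \<Longrightarrow> nbhd \<rho> k j \<in> sets lebesgue"
  by (simp add: nbhd_eq_hcube)

lemma measurable_idx:
  assumes "0 < \<rho>"
  shows "(idx \<rho> k :: real^'n \<Rightarrow> 'n \<Rightarrow> int) \<in> measurable lebesgue (count_space UNIV)"
proof -
  have "idx \<rho> k -` {a} \<inter> space lebesgue = cell \<rho> k a" for a :: "'n \<Rightarrow> int"
    by (auto simp: cell_def)
  then show ?thesis
    using assms by (subst measurable_count_space_eq2_countable) auto
qed

lemma emeasure_cell: "0 < \<rho> \<Longrightarrow> emeasure lebesgue (cell \<rho> k (j :: 'n::finite \<Rightarrow> int)) = ennreal (side \<rho> k ^ CARD('n))"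
  using side_pos[of \<rho> k] by (simp add: cell_eq_hcube emeasure_hcube)

lemma emeasure_nbhd:
  "0 < \<rho> \<Longrightarrow> emeasure lebesgue (nbhd \<rho> k (j :: 'n::finite \<Rightarrow> int)) = ennreal (3 ^ CARD('n) * side \<rho> k ^ CARD('n))"
  using side_pos[of \<rho> k] by (simp add: nbhd_eq_hcube emeasure_hcube power_mult_distrib)

lemma infnorm_less_iff: "infnorm (z :: real^'n) < r \<longleftrightarrow> (\<forall>i. \<bar>z $ i\<bar> < r)"
  by (auto simp: infnorm_Max Basis_vec_def cart_eq_inner_axis)

lemma idx_eq_imp_infnorm:
  assumes "0 < \<rho>" "idx \<rho> k x = idx \<rho> k y"
  shows "infnorm (x - y) < side \<rho> k"
proof -
  have "\<bar>x $ i - y $ i\<bar> < side \<rho> k" for i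
  proof -
    have "\<lfloor>x $ i / side \<rho> k\<rfloor> = \<lfloor>y $ i / side \<rho> k\<rfloor>"
      using assms(2) by (auto simp: idx_def fun_eq_iff)
    then have "\<bar>x $ i / side \<rho> k - y $ i / side \<rho> k\<bar> < 1" by linarith
    then have "\<bar>x $ i - y $ i\<bar> / side \<rho> k < 1"
      using side_pos[OF assms(1), of k] by (simp add: diff_divide_distrib[symmetric] abs_divide)
    then show ?thesis using side_pos[OF assms(1), of k] by simp
  qed
  then show ?thesis by (simp add: infnorm_less_iff)
qed

lemma infnorm_imp_near:
  assumes "0 < \<rho>" "infnorm (x - y) < side \<rho> k"
  shows "near (idx \<rho> k x) (idx \<rho> k y)"
proof -
  have "\<bar>\<lfloor>x $ i / side \<rho> k\<rfloor> - \<lfloor>y $ i / side \<rho> k\<rfloor>\<bar> \<le> 1" for i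
  proof -
    have "\<bar>x $ i - y $ i\<bar> < side \<rho> k"
      using assms(2) by (simp add: infnorm_less_iff)
    then have "\<bar>x $ i / side \<rho> k - y $ i / side \<rho> k\<bar> < 1"
      using side_pos[OF assms(1), of k] by (simp add: diff_divide_distrib[symmetric] abs_divide)
    then show ?thesis by linarith
  qed
  then show ?thesis by (simp add: near_def idx_def)
qed

section \<open>The weight on dyadic cells\<close>

text \<open>The scale \<open>2 * \<rho>\<close> is the one at which two adjacent cells of the
  coarsest generation, of side \<rho>, fit in a common cube.\<close>

locale A_infty_weight =
  fixes \<sigma> :: "real^'n \<Rightarrow> real" and \<rho> K :: real
  assumes w: "weight \<sigma>" and \<rho>: "0 < \<rho>" and K: "1 \<le> K"
    and A: "A_infty_const (2 * \<rho>) \<sigma> \<le> ennreal K"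
begin

definition S :: "(real^'n) measure" where
  "S = density lebesgue (\<lambda>x. ennreal (\<sigma> x))"

text \<open>\<open>B\<close> is the loss in passing from a cell to half of it, \<open>D\<close> the
  loss in passing from a cube to a cell of half its side.\<close>

definition B :: real where "B = frac_const K (1 / 2)"

definition D :: real where "D = frac_const K ((1 / 2) ^ CARD('n))"

lemma B_pos: "0 < B" and D_pos: "0 < D"
  using K by (auto simp: B_def D_def frac_const_def)

lemma \<sigma>_measurable [measurable]: "\<sigma> \<in> borel_measurable lebesgue"
  using w by (rule weight_measurable)

lemma sets_S [simp, measurable_cong]: "sets S = sets lebesgue"
  by (simp add: S_def)

lemma emeasure_S: "E \<in> sets lebesgue \<Longrightarrow> emeasure S E = (\<integral>\<^sup>+x\<in>E. ennreal (\<sigma> x) \<partial>lebesgue)"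
  unfolding S_def by (subst emeasure_density) auto

lemma emeasure_S_hcube:
  "E \<in> sets lebesgue \<Longrightarrow> E \<subseteq> hcube a l \<Longrightarrow> emeasure S E = ennreal (LINT x:E|lebesgue. \<sigma> x)"
  by (simp add: emeasure_S weight_nn_integral[OF w])

lemma S_fraction:
  assumes l: "0 < l" "l \<le> 2 * \<rho>" and F: "F \<in> sets lebesgue" "F \<subseteq> hcube a l"
    and th: "0 < \<theta>" "ennreal (\<theta> * l ^ CARD('n)) \<le> emeasure lebesgue F"
  shows "emeasure S (hcube a l) \<le> ennreal (frac_const K \<theta>) * emeasure S F"
proof -
  have "emeasure lebesgue F \<le> emeasure lebesgue (hcube a l)"
    using F by (intro emeasure_mono) auto
  then have "emeasure lebesgue F = ennreal (measure lebesgue F)"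
    using l by (intro emeasure_eq_ennreal_measure) (auto simp: emeasure_hcube top_unique)
  then have "\<theta> * l ^ CARD('n) \<le> measure lebesgue F"
    using th by simp
  from A_infty_fraction[OF w A K l F th(1) this]
  show ?thesis
    using F th K unfolding emeasure_S_hcube[OF hcube_sets order_refl] emeasure_S_hcube[OF F]
    by (subst ennreal_mult'[symmetric]) (auto simp: frac_const_def intro!: ennreal_leI)
qed

lemma S_cell_pos: "0 < emeasure S (cell \<rho> k j)" and S_cell_finite: "emeasure S (cell \<rho> k j) < \<infinity>"
proof -
  have "emeasure S (cell \<rho> k j) = ennreal (LINT x:cell \<rho> k j|lebesgue. \<sigma> x)"
    using \<rho> by (intro emeasure_S_hcube) (auto simp: cell_eq_hcube)
  moreover have "0 < (LINT x:cell \<rho> k j|lebesgue. \<sigma> x)"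
    unfolding cell_eq_hcube[OF \<rho>] using side_pos[OF \<rho>, of k]
    by (intro weight_integral_pos[OF w _ order_refl]) (auto simp: measure_hcube)
  ultimately show "0 < emeasure S (cell \<rho> k j)" "emeasure S (cell \<rho> k j) < \<infinity>" by auto
qed

lemma S_half:
  assumes "F \<in> sets lebesgue" "F \<subseteq> cell \<rho> k j" "ennreal (1/2 * side \<rho> k ^ CARD('n)) \<le> emeasure lebesgue F"
  shows "emeasure S (cell \<rho> k j) \<le> ennreal B * emeasure S F"
  unfolding B_def cell_eq_hcube[OF \<rho>]
  using assms side_pos[OF \<rho>, of k] side_le[OF \<rho>, of k] \<rho>
  by (intro S_fraction) (auto simp: cell_eq_hcube)

text \<open>Adjacent cells lie in the cube of twice their side whose corner is the coordinatewise
  minimum of their corners, and the cell on the right fills the fraction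
  \<open>(1 / 2) ^ CARD('n)\<close> of it.\<close>

lemma S_near:
  assumes "near i j"
  shows "emeasure S (cell \<rho> k i) \<le> ennreal D * emeasure S (cell \<rho> k j)"
proof -
  let ?s = "side \<rho> k"
  let ?a = "(\<chi> c. of_int (min (i c) (j c)) * ?s) :: real^'n"
  have s: "0 < ?s" "2 * ?s \<le> 2 * \<rho>" using side_pos[OF \<rho>] side_le[OF \<rho>] by auto
  have sub: "cell \<rho> k i' \<subseteq> hcube ?a (2 * ?s)" if "i' = i \<or> i' = j" for i'
  proof
    fix y assume "y \<in> cell \<rho> k i'"
    then have y: "of_int (i' c) * ?s \<le> y $ c" "y $ c < of_int (i' c) * ?s + ?s" for c
      using \<rho> by (auto simp: cell_eq_hcube hcube_def)
    have "of_int (min (i c) (j c)) * ?s \<le> y $ c \<and> y $ c < of_int (min (i c) (j c)) * ?s + 2 * ?s" for c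
    proof -
      have "min (i c) (j c) \<le> i' c" "i' c \<le> min (i c) (j c) + 1"
        using that assms[unfolded near_def, rule_format, of c] by auto
      then have "of_int (min (i c) (j c)) * ?s \<le> of_int (i' c) * ?s"
        "of_int (i' c) * ?s \<le> of_int (min (i c) (j c) + 1) * ?s"
        using s(1) by (auto intro!: mult_right_mono simp only: of_int_le_iff)
      moreover have "of_int (min (i c) (j c) + 1) * ?s = of_int (min (i c) (j c)) * ?s + ?s"
        by (simp only: of_int_add of_int_1 distrib_right mult_1)
      ultimately show ?thesis using y[of c] by linarith
    qed
    then show "y \<in> hcube ?a (2 * ?s)"
      by (simp only: hcube_def mem_Collect_eq vec_lambda_beta) blast
  qed
  have "emeasure S (cell \<rho> k i) \<le> emeasure S (hcube ?a (2 * ?s))"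
    using sub by (intro emeasure_mono) auto
  also have "\<dots> \<le> ennreal D * emeasure S (cell \<rho> k j)"
    unfolding D_def using s sub \<rho>
    by (intro S_fraction) (auto simp: emeasure_cell power_mult_distrib power_divide)
  finally show ?thesis .
qed

lemma S_nbhd: "emeasure S (nbhd \<rho> k j) \<le> ennreal (3 ^ CARD('n) * D) * emeasure S (cell \<rho> k j)"
proof -
  have "emeasure S (nbhd \<rho> k j) \<le> (\<Sum>i\<in>{i. near i j}. emeasure S (cell \<rho> k i))"
    unfolding nbhd_eq_UN using \<rho> by (intro emeasure_subadditive_finite finite_near) auto
  also have "\<dots> \<le> (\<Sum>i\<in>{i. near i j}. ennreal D * emeasure S (cell \<rho> k j))"
    by (intro sum_mono S_near) auto
  also have "\<dots> = ennreal (3 ^ CARD('n) * D) * emeasure S (cell \<rho> k j)"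
    using D_pos by (simp add: card_near ennreal_mult mult.assoc ennreal_power[symmetric])
  finally show ?thesis .
qed

end

section \<open>Preliminaries on integrals\<close>

lemma sigma_finite_lebesgue: "sigma_finite_measure (lebesgue :: 'a::euclidean_space measure)"
proof
  show "\<exists>A. countable A \<and> A \<subseteq> sets lebesgue \<and> \<Union>A = space (lebesgue :: 'a measure)
      \<and> (\<forall>a\<in>A. emeasure lebesgue a \<noteq> \<infinity>)"
  proof (intro exI conjI)
    let ?A = "range (\<lambda>n :: nat. cball (0 :: 'a) (real n))"
    show "countable ?A" "?A \<subseteq> sets lebesgue" by auto
    show "\<Union>?A = space lebesgue"
      by (auto simp: dist_norm intro: real_arch_simple)
    show "\<forall>a\<in>?A. emeasure lebesgue a \<noteq> \<infinity>"
      using emeasure_lborel_cball_finite by (auto simp: emeasure_completion less_top)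
  qed
qed

text \<open>The indicator of a union is at most the sum of the indicators. Writing that sum as an
  integral over the counting measure allows index sets such as sets of cell indices.\<close>

lemma emeasure_UN_le_nn_integral:
  assumes "countable I" "\<And>i. i \<in> I \<Longrightarrow> A i \<in> sets M"
  shows "emeasure M (\<Union>i\<in>I. A i) \<le> (\<integral>\<^sup>+i. emeasure M (A i) \<partial>count_space I)"
proof -
  have "emeasure M (\<Union>i\<in>I. A i) = (\<integral>\<^sup>+x. indicator (\<Union>i\<in>I. A i) x \<partial>M)"
    using assms by (intro nn_integral_indicator[symmetric] sets.countable_UN') auto
  also have "\<dots> \<le> (\<integral>\<^sup>+x. (\<integral>\<^sup>+i. indicator (A i) x \<partial>count_space I) \<partial>M)"
  proof (rule nn_integral_mono)
    fix x
    show "indicator (\<Union>i\<in>I. A i) x \<le> (\<integral>\<^sup>+i. indicator (A i) x \<partial>count_space I)"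
    proof (cases "x \<in> (\<Union>i\<in>I. A i)")
      case True
      then obtain i where "i \<in> I" "x \<in> A i" by auto
      then have "(1 :: ennreal) \<le> (\<integral>\<^sup>+i. indicator (A i) x \<partial>count_space I)"
        using nn_integral_ge_point[of i I "\<lambda>i. indicator (A i) x"] by auto
      then show ?thesis by (auto simp: indicator_def)
    qed auto
  qed
  also have "\<dots> = (\<integral>\<^sup>+i. emeasure M (A i) \<partial>count_space I)"
    using assms by (subst nn_integral_count_space_nn_integral)
      (auto intro!: nn_integral_cong_simp simp: simp_implies_def)
  finally show ?thesis .
qed

lemma powr_layer_real:
  fixes b q :: real
  assumes "0 < q" "0 \<le> b"
  shows "(\<integral>\<^sup>+t. ennreal (q * t powr (q - 1)) * indicator {t. 0 < t \<and> t < b} t \<partial>lborel) = ennreal (b powr q)"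
proof -
  have "((\<lambda>t. q * t powr (q - 1)) has_integral (q * (b powr (q - 1 + 1) / (q - 1 + 1)))) {0..b}"
    using assms by (intro has_integral_mult_right has_integral_powr_from_0) auto
  from nn_integral_has_integral_lebesgue[OF _ this] assms
  have "(\<integral>\<^sup>+t. ennreal (indicator {0..b} t * (q * t powr (q - 1))) \<partial>lborel) = ennreal (b powr q)"
    by auto
  moreover have "AE t in lborel. t \<noteq> 0" "AE t in lborel. t \<noteq> b"
    by (rule AE_lborel_singleton)+
  then have "AE t in lborel. ennreal (q * t powr (q - 1)) * indicator {t. 0 < t \<and> t < b} t
      = ennreal (indicator {0..b} t * (q * t powr (q - 1)))"
    by eventually_elim (auto simp: indicator_def)
  ultimately show ?thesis by (subst nn_integral_cong_AE)
qed

lemma powr_layer: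
  assumes "0 < q"
  shows "(\<integral>\<^sup>+t. ennreal (q * t powr (q - 1)) * indicator {t. 0 < t \<and> ennreal t < g} t \<partial>lborel) = ennpowr g q"
proof (cases g)
  case (real b)
  have "{t. 0 < t \<and> ennreal t < g} = {t. 0 < t \<and> t < b}"
    using real by (auto simp: ennreal_less_iff)
  then show ?thesis using powr_layer_real[OF assms real(1)] real by (simp add: ennpowr_def)
next
  case top
  have "ennreal (real n) \<le> (\<integral>\<^sup>+t. ennreal (q * t powr (q - 1)) * indicator {t. 0 < t \<and> ennreal t < g} t \<partial>lborel)" for n :: nat
  proof -
    \<comment> \<open>Stopping the levels at this point gives exactly \<open>n\<close>, so the full
      integral is at least every natural number.\<close>
    let ?b = "real n powr (1 / q)"
    have "ennreal (real n) = ennreal (?b powr q)"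
      using assms by (simp add: powr_powr)
    also have "\<dots> = (\<integral>\<^sup>+t. ennreal (q * t powr (q - 1)) * indicator {t. 0 < t \<and> t < ?b} t \<partial>lborel)"
      using powr_layer_real[OF assms, of ?b] by simp
    also have "\<dots> \<le> (\<integral>\<^sup>+t. ennreal (q * t powr (q - 1)) * indicator {t. 0 < t \<and> ennreal t < g} t \<partial>lborel)"
      using top by (intro nn_integral_mono mult_left_mono) (auto simp: indicator_def)
    finally show ?thesis .
  qed
  then have "(\<integral>\<^sup>+t. ennreal (q * t powr (q - 1)) * indicator {t. 0 < t \<and> ennreal t < g} t \<partial>lborel) = \<infinity>"
    (is "?I = _")
    using ennreal_Ex_less_of_nat[of ?I]
    by (cases "?I < top") (auto simp: ennreal_of_nat_eq_real_of_nat not_less[symmetric] less_top[symmetric])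
  then show ?thesis using top by (simp add: ennpowr_def)
qed

lemma measurable_ennpowr [measurable]:
  assumes [measurable]: "f \<in> borel_measurable M"
  shows "(\<lambda>x. ennpowr (f x) q) \<in> borel_measurable M"
  unfolding ennpowr_def by measurable

lemma nn_integral_cmult2:
  assumes [measurable]: "h \<in> borel_measurable M"
  shows "(\<integral>\<^sup>+x. a * (b * h x) \<partial>M) = a * (b * (\<integral>\<^sup>+x. h x \<partial>M))"
  by (simp add: nn_integral_cmult)

section \<open>The maximal function of the quotients: weak and strong type bounds\<close>

context A_infty_weight
begin

definition \<nu> :: "(real^'n \<Rightarrow> ennreal) \<Rightarrow> (real^'n) measure" where
  "\<nu> f = density lebesgue f"

lemma sets_\<nu> [simp, measurable_cong]: "sets (\<nu> f) = sets lebesgue"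
  by (simp add: \<nu>_def)

lemma emeasure_\<nu>:
  "f \<in> borel_measurable lebesgue \<Longrightarrow> E \<in> sets lebesgue \<Longrightarrow> emeasure (\<nu> f) E = (\<integral>\<^sup>+x\<in>E. f x \<partial>lebesgue)"
  unfolding \<nu>_def by (subst emeasure_density) auto

text \<open>The doubling constant of \<open>S\<close> from a cell to its neighbourhood, by
  \<open>S_nbhd\<close>.\<close>

definition N :: real where "N = 3 ^ CARD('n) * D"

lemma N_pos: "0 < N"
  using D_pos by (simp add: N_def)

lemma idx_pred_sets: "{z. P (idx \<rho> k z)} \<in> sets (lebesgue :: (real^'n) measure)"
  using measurable_sets[OF measurable_idx[OF \<rho>], of "{i. P i}" k] by (simp add: vimage_def)

text \<open>\<open>T k\<close> collects the cells of generation \<open>k\<close> that are maximal with density above \<open>r\<close>;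
  a cell contained in none of them but next to a cell of large density is still next to a maximal one.\<close>

lemma weak_type_stopping:
  fixes r :: ennreal
  assumes f [measurable]: "f \<in> borel_measurable lebesgue"
  defines "high \<equiv> \<lambda>k i. r * emeasure S (cell \<rho> k i) < emeasure (\<nu> f) (cell \<rho> k i)"
  shows "r * emeasure S {y. \<exists>k i. near (idx \<rho> k y) i \<and> high k i} \<le> ennreal N * (\<integral>\<^sup>+x. f x \<partial>lebesgue)"
proof -
  \<comment> \<open>\<open>T k\<close> is defined by points, which makes disjointness for different
    \<open>k\<close> immediate. It is a union of cells, since the index of generation
    \<open>k\<close> determines all coarser indices; \<open>J k\<close> lists these cells.\<close>
  define T where "T k = {z :: real^'n. high k (idx \<rho> k z) \<and> (\<forall>j<k. \<not> high j (idx \<rho> j z))}" for k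
  define J where "J k = idx \<rho> k ` T k" for k
  define U where "U k = (\<Union>i\<in>J k. nbhd \<rho> k i)" for k
  have Tsets [measurable]: "T k \<in> sets lebesgue" for k
  proof -
    have "T k = {z. high k (idx \<rho> k z)} - (\<Union>j<k. {z. high j (idx \<rho> j z)})"
      by (auto simp: T_def)
    also have "\<dots> \<in> sets lebesgue"
      by (intro sets.Diff sets.finite_UN idx_pred_sets) auto
    finally show ?thesis .
  qed
  have cellT: "cell \<rho> k i \<subseteq> T k" if "i \<in> J k" for i k
  proof
    fix z assume "z \<in> cell \<rho> k i"
    then have "idx \<rho> k z \<in> idx \<rho> k ` T k"
      using that by (simp add: J_def cell_def)
    then obtain z' where z': "z' \<in> T k" "idx \<rho> k z = idx \<rho> k z'"
      by (elim imageE)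
    then have "idx \<rho> j z = idx \<rho> j z'" if "j \<le> k" for j
      using idx_eq_le that by blast
    then show "z \<in> T k"
      using z'(1) by (auto simp: T_def)
  qed
  have T_eq: "T k = (\<Union>i\<in>J k. cell \<rho> k i)" for k
    using cellT by (auto simp: J_def cell_def)
  have dis: "disjoint_family_on (cell \<rho> k) I" for k and I :: "('n \<Rightarrow> int) set"
    by (auto simp: disjoint_family_on_def cell_def)
  have Usets [measurable]: "U k \<in> sets lebesgue" for k
    unfolding U_def using \<rho> by (intro sets.countable_UN') auto
  have MT: "emeasure M (T k) = (\<integral>\<^sup>+i. emeasure M (cell \<rho> k i) \<partial>count_space (J k))"
    if "sets M = sets lebesgue" for M k
    unfolding T_eq using \<rho> that by (intro emeasure_UN_countable dis) auto
  have SU: "emeasure S (U k) \<le> ennreal N * emeasure S (T k)" for k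
  proof -
    have "emeasure S (U k) \<le> (\<integral>\<^sup>+i. emeasure S (nbhd \<rho> k i) \<partial>count_space (J k))"
      unfolding U_def using \<rho> by (intro emeasure_UN_le_nn_integral) auto
    also have "\<dots> \<le> (\<integral>\<^sup>+i. ennreal N * emeasure S (cell \<rho> k i) \<partial>count_space (J k))"
      unfolding N_def by (intro nn_integral_mono S_nbhd)
    also have "\<dots> = ennreal N * emeasure S (T k)"
      by (subst nn_integral_cmult) (auto simp: MT)
    finally show ?thesis .
  qed
  have ST: "r * emeasure S (T k) \<le> emeasure (\<nu> f) (T k)" for k
  proof -
    have "r * emeasure S (T k) = (\<integral>\<^sup>+i. r * emeasure S (cell \<rho> k i) \<partial>count_space (J k))"
      by (subst nn_integral_cmult) (auto simp: MT)
    also have "\<dots> \<le> (\<integral>\<^sup>+i. emeasure (\<nu> f) (cell \<rho> k i) \<partial>count_space (J k))"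
      by (intro nn_integral_mono) (auto simp: J_def T_def high_def less_imp_le)
    finally show ?thesis by (simp add: MT)
  qed
  have sub: "{y. \<exists>k i. near (idx \<rho> k y) i \<and> high k i} \<subseteq> (\<Union>k. U k)"
  proof
    fix y assume "y \<in> {y. \<exists>k i. near (idx \<rho> k y) i \<and> high k i}"
    then obtain k i where ki: "near (idx \<rho> k y) i" "high k i" by auto
    \<comment> \<open>Positive mass supplies a point \<open>z\<close> of the cell, and the ancestors
      of the cell are then the cells containing \<open>z\<close>.\<close>
    have "emeasure S (cell \<rho> k i) \<noteq> 0"
      using S_cell_pos[of k i] by auto
    then have "cell \<rho> k i \<noteq> {}" by auto
    then obtain z where z: "idx \<rho> k z = i" by (auto simp: cell_def)
    define j where "j = (LEAST j. high j (idx \<rho> j z))"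
    have h: "high k (idx \<rho> k z)" using ki z by simp
    have "high j (idx \<rho> j z)" and j: "j \<le> k"
      unfolding j_def by (rule LeastI[of _ k] Least_le, rule h)+
    moreover have "\<not> high i (idx \<rho> i z)" if "i < j" for i
      using that unfolding j_def by (rule not_less_Least)
    ultimately have zT: "z \<in> T j"
      by (simp add: T_def)
    from j have "near (idx \<rho> j y) (idx \<rho> j z)"
      using near_le[of j k \<rho> y z] ki z by simp
    then show "y \<in> (\<Union>k. U k)"
      using zT by (auto simp: U_def J_def nbhd_def)
  qed
  have disT: "disjoint_family T"
  proof -
    have "T j \<inter> T k = {}" if "j < k" for j k using that by (auto simp: T_def)
    then show ?thesis
      unfolding disjoint_family_on_def by (metis Int_commute linorder_neqE_nat)
  qed
  have "r * emeasure S {y. \<exists>k i. near (idx \<rho> k y) i \<and> high k i} \<le> r * emeasure S (\<Union>k. U k)"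
    using sub by (intro mult_left_mono emeasure_mono) auto
  also have "\<dots> \<le> r * (\<Sum>k. emeasure S (U k))"
    by (intro mult_left_mono emeasure_subadditive_countably) auto
  also have "\<dots> \<le> r * (\<Sum>k. ennreal N * emeasure S (T k))"
    by (intro mult_left_mono suminf_le SU) auto
  also have "\<dots> = ennreal N * (\<Sum>k. r * emeasure S (T k))"
    by (simp add: mult.left_commute)
  also have "\<dots> \<le> ennreal N * (\<Sum>k. emeasure (\<nu> f) (T k))"
    by (intro mult_left_mono suminf_le ST) auto
  also have "(\<Sum>k. emeasure (\<nu> f) (T k)) = emeasure (\<nu> f) (\<Union>k. T k)"
    by (rule suminf_emeasure) (use disT in auto)
  also have "\<dots> \<le> emeasure (\<nu> f) UNIV"
    by (intro emeasure_mono) auto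
  also have "\<dots> = (\<integral>\<^sup>+x. f x \<partial>lebesgue)"
    by (subst emeasure_\<nu>) auto
  finally show ?thesis by (simp add: mult_left_mono)
qed

text \<open>For \<open>f = h * \<sigma>\<close> this is a dyadic maximal function of
  \<open>h\<close> with respect to \<open>S\<close>, with the numerator taken over the tripled cube.
  Using \<open>f\<close> itself avoids a division by the weight.\<close>

definition G :: "(real^'n \<Rightarrow> ennreal) \<Rightarrow> real^'n \<Rightarrow> ennreal" where
  "G f y = (SUP k. emeasure (\<nu> f) (nbhd \<rho> k (idx \<rho> k y)) / emeasure S (cell \<rho> k (idx \<rho> k y)))"

lemma measurable_idx_compose: "(\<lambda>y. h (idx \<rho> k y)) \<in> borel_measurable (lebesgue :: (real^'n) measure)"
  by (rule measurable_compose[OF measurable_idx[OF \<rho>]]) simp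

lemma measurable_G [measurable]: "G f \<in> borel_measurable lebesgue"
  unfolding G_def
  by (intro borel_measurable_SUP measurable_idx_compose[of "\<lambda>i. emeasure (\<nu> f) (nbhd \<rho> _ i) / emeasure S (cell \<rho> _ i)"]) auto

lemma G_sets: "{y. c < G f y} \<in> sets lebesgue"
proof -
  have "{y \<in> space lebesgue. c < G f y} \<in> sets lebesgue" by measurable
  then show ?thesis by simp
qed

text \<open>Cut \<open>f\<close> at a small multiple of \<sigma>. By doubling, the lower part
  contributes at most \<open>r / 2\<close> to every quotient. Where the maximal function exceeds
  \<open>r\<close>, the upper part must therefore have large density in some neighbouring cell, and
  \<open>weak_type_stopping\<close> applies to the upper part alone.\<close>

lemma G_weak_type:
  fixes r :: real
  assumes f [measurable]: "f \<in> borel_measurable lebesgue" and l: "0 < r"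
  shows "ennreal r * emeasure S {y. ennreal r < G f y} \<le>
    ennreal (2 * N\<^sup>2) * (\<integral>\<^sup>+x. f x * indicator {x. ennreal (r / (2 * N) * \<sigma> x) < f x} x \<partial>lebesgue)"
proof -
  \<comment> \<open>With this value both contributions are at most \<open>r / 2\<close>: the lower
    part through the mass of the neighbourhood, the upper part through its
    \<open>3 ^ CARD('n)\<close> cells, each costing a factor \<open>D\<close>.\<close>
  define \<kappa> where "\<kappa> = r / (2 * N)"
  have \<kappa>: "0 < \<kappa>" "\<kappa> * N = r / 2" using l N_pos by (auto simp: \<kappa>_def)
  define g where "g x = f x * indicator {x. ennreal (\<kappa> * \<sigma> x) < f x} x" for x
  have [measurable]: "g \<in> borel_measurable lebesgue"
    unfolding g_def by measurable
  have fg: "emeasure (\<nu> f) E \<le> emeasure (\<nu> g) E + ennreal \<kappa> * emeasure S E" if E: "E \<in> sets lebesgue" for E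
  proof -
    have "emeasure (\<nu> f) E \<le> (\<integral>\<^sup>+x. g x * indicator E x + ennreal \<kappa> * (ennreal (\<sigma> x) * indicator E x) \<partial>lebesgue)"
      using E \<kappa> weight_nonneg[OF w] by (auto simp: emeasure_\<nu> g_def indicator_def ennreal_mult' intro!: nn_integral_mono)
    also have "\<dots> = emeasure (\<nu> g) E + ennreal \<kappa> * emeasure S E"
      using E by (subst nn_integral_add) (auto simp: emeasure_\<nu> emeasure_S nn_integral_cmult)
    finally show ?thesis .
  qed
  have "{y. ennreal r < G f y} \<subseteq>
      {y. \<exists>k i. near (idx \<rho> k y) i \<and> ennreal \<kappa> * emeasure S (cell \<rho> k i) < emeasure (\<nu> g) (cell \<rho> k i)}"
  proof
    fix y assume "y \<in> {y. ennreal r < G f y}"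
    then obtain k where k: "ennreal r < emeasure (\<nu> f) (nbhd \<rho> k (idx \<rho> k y)) / emeasure S (cell \<rho> k (idx \<rho> k y))"
      by (auto simp: G_def less_SUP_iff)
    let ?j = "idx \<rho> k y"
    have "\<exists>i. near i ?j \<and> ennreal \<kappa> * emeasure S (cell \<rho> k i) < emeasure (\<nu> g) (cell \<rho> k i)"
    proof (rule ccontr)
      assume "\<not> ?thesis"
      then have le: "emeasure (\<nu> g) (cell \<rho> k i) \<le> ennreal \<kappa> * emeasure S (cell \<rho> k i)" if "near i ?j" for i
        using that by (auto simp: not_less)
      have "emeasure (\<nu> g) (nbhd \<rho> k ?j) \<le> (\<Sum>i\<in>{i. near i ?j}. emeasure (\<nu> g) (cell \<rho> k i))"
        unfolding nbhd_eq_UN using \<rho> by (intro emeasure_subadditive_finite finite_near) auto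
      also have "\<dots> \<le> (\<Sum>i\<in>{i. near i ?j}. ennreal \<kappa> * (ennreal D * emeasure S (cell \<rho> k ?j)))"
        by (intro sum_mono order_trans[OF le] mult_left_mono S_near) auto
      also have "\<dots> = ennreal (r / 2) * emeasure S (cell \<rho> k ?j)"
        unfolding \<kappa>(2)[symmetric] N_def using \<kappa> D_pos
        by (simp add: card_near ennreal_mult ennreal_power[symmetric] mult_ac)
      finally have 1: "emeasure (\<nu> g) (nbhd \<rho> k ?j) \<le> ennreal (r / 2) * emeasure S (cell \<rho> k ?j)" .
      have "ennreal \<kappa> * emeasure S (nbhd \<rho> k ?j) \<le> ennreal \<kappa> * (ennreal N * emeasure S (cell \<rho> k ?j))"
        unfolding N_def by (intro mult_left_mono S_nbhd) auto
      also have "\<dots> = ennreal (r / 2) * emeasure S (cell \<rho> k ?j)"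
        unfolding \<kappa>(2)[symmetric] using \<kappa> N_pos by (simp add: ennreal_mult mult.assoc)
      finally have "emeasure (\<nu> f) (nbhd \<rho> k ?j) \<le>
          ennreal (r / 2) * emeasure S (cell \<rho> k ?j) + ennreal (r / 2) * emeasure S (cell \<rho> k ?j)"
        using fg[of "nbhd \<rho> k ?j"] 1 \<rho> by (auto elim!: order_trans intro!: add_mono)
      also have "\<dots> = ennreal r * emeasure S (cell \<rho> k ?j)"
        using l by (simp add: distrib_right[symmetric] ennreal_plus[symmetric] del: ennreal_plus)
      finally have "emeasure (\<nu> f) (nbhd \<rho> k ?j) / emeasure S (cell \<rho> k ?j) \<le> ennreal r"
        by (auto intro!: divide_le_posI_ennreal S_cell_pos simp: mult.commute)
      then show False using k by simp
    qed
    then show "y \<in> {y. \<exists>k i. near (idx \<rho> k y) i \<and> ennreal \<kappa> * emeasure S (cell \<rho> k i) < emeasure (\<nu> g) (cell \<rho> k i)}"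
      using near_sym by auto
  qed
  moreover have "{y. \<exists>k i. near (idx \<rho> k y) i \<and> ennreal \<kappa> * emeasure S (cell \<rho> k i) < emeasure (\<nu> g) (cell \<rho> k i)}
      = (\<Union>k. {y. \<exists>i. near (idx \<rho> k y) i \<and> ennreal \<kappa> * emeasure S (cell \<rho> k i) < emeasure (\<nu> g) (cell \<rho> k i)})"
    by auto
  moreover have "\<dots> \<in> sets lebesgue"
    by (rule sets.countable_UN'[OF countableI_type])
      (auto intro: idx_pred_sets[of "\<lambda>j. \<exists>i. near j i \<and> ennreal \<kappa> * emeasure S (cell \<rho> k i) < emeasure (\<nu> g) (cell \<rho> k i)" k for k])
  ultimately have "emeasure S {y. ennreal r < G f y} \<le> emeasure S
      {y. \<exists>k i. near (idx \<rho> k y) i \<and> ennreal \<kappa> * emeasure S (cell \<rho> k i) < emeasure (\<nu> g) (cell \<rho> k i)}"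
    by (intro emeasure_mono) auto
  then have "ennreal \<kappa> * emeasure S {y. ennreal r < G f y} \<le> ennreal N * (\<integral>\<^sup>+x. g x \<partial>lebesgue)"
    by (intro order_trans[OF mult_left_mono weak_type_stopping]) auto
  then have "ennreal (2 * N) * (ennreal \<kappa> * emeasure S {y. ennreal r < G f y})
      \<le> ennreal (2 * N) * (ennreal N * (\<integral>\<^sup>+x. g x \<partial>lebesgue))"
    by (intro mult_left_mono) auto
  moreover have "ennreal (2 * N) * ennreal \<kappa> = ennreal r"
    using N_pos \<kappa>(1) by (simp add: ennreal_mult[symmetric] \<kappa>_def)
  moreover have "ennreal (2 * N) * ennreal N = ennreal (2 * N\<^sup>2)"
    using N_pos by (simp add: ennreal_mult[symmetric] power2_eq_square)
  ultimately show ?thesis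
    by (simp add: mult.assoc[symmetric] g_def \<kappa>_def)
qed

text \<open>Interpolation in the style of Marcinkiewicz: write the power by levels, insert the weak
  type bound and exchange the integrals. For fixed \<open>x\<close> the truncation restricts
  \<open>t\<close> to values below \<open>2 * N * f x / \<sigma> x\<close>, so the inner integral is
  a multiple of \<open>f * (f / \<sigma>)^(p-1)\<close>. This is \<open>f^p * \<omega>\<close> by
  the definition of the dual weight.\<close>

lemma G_strong_type:
  assumes f [measurable]: "f \<in> borel_measurable lebesgue" and p: "1 < p"
    and om [measurable]: "\<omega> \<in> borel_measurable lebesgue" and pos: "AE x in lebesgue. 0 < \<omega> x"
    and dual: "\<sigma> = dual_weight p \<omega>"
  shows "(\<integral>\<^sup>+y. ennpowr (G f y) p * ennreal (\<sigma> y) \<partial>lebesgue) \<le>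
    ennreal (2 * N\<^sup>2 * (p / (p - 1)) * (2 * N) powr (p - 1)) * (\<integral>\<^sup>+x. ennpowr (f x) p * ennreal (\<omega> x) \<partial>lebesgue)"
proof -
  interpret L: sigma_finite_measure "lebesgue :: (real^'n) measure" by (rule sigma_finite_lebesgue)
  interpret P: pair_sigma_finite lborel "lebesgue :: (real^'n) measure" ..
  let ?w = "\<lambda>t. ennreal (p * t powr (p - 1))"
  \<comment> \<open>This is \<open>p * t powr (p - 2)\<close>, written as a multiple of the level
    density for the exponent \<open>p - 1\<close>; the factor \<open>p / (p - 1)\<close> of the
    bound originates here.\<close>
  let ?v = "\<lambda>t. ennreal (p / (p - 1) * ((p - 1) * t powr (p - 1 - 1)))"
  let ?c = "ennreal (2 * N\<^sup>2)"
  have "(\<integral>\<^sup>+y. ennpowr (G f y) p * ennreal (\<sigma> y) \<partial>lebesgue)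
      = (\<integral>\<^sup>+y. (\<integral>\<^sup>+t. ?w t * indicator {t. 0 < t \<and> ennreal t < G f y} t * ennreal (\<sigma> y) \<partial>lborel) \<partial>lebesgue)"
    using p by (intro nn_integral_cong) (simp add: nn_integral_multc powr_layer)
  also have "\<dots> = (\<integral>\<^sup>+t. (\<integral>\<^sup>+y. ?w t * indicator {t. 0 < t \<and> ennreal t < G f y} t * ennreal (\<sigma> y) \<partial>lebesgue) \<partial>lborel)"
    by (rule P.Fubini') measurable
  also have "\<dots> \<le> (\<integral>\<^sup>+t. (\<integral>\<^sup>+x. ?c * (?v t * (indicator {t. 0 < t \<and> ennreal (t / (2 * N) * \<sigma> x) < f x} t * f x)) \<partial>lebesgue) \<partial>lborel)"
  proof (rule nn_integral_mono)
    fix t :: real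
    show "(\<integral>\<^sup>+y. ?w t * indicator {t. 0 < t \<and> ennreal t < G f y} t * ennreal (\<sigma> y) \<partial>lebesgue) \<le>
      (\<integral>\<^sup>+x. ?c * (?v t * (indicator {t. 0 < t \<and> ennreal (t / (2 * N) * \<sigma> x) < f x} t * f x)) \<partial>lebesgue)"
    proof (cases "0 < t")
      case True
      have wv: "?w t = ?v t * ennreal t"
        using True p by (simp add: ennreal_mult'[symmetric] powr_diff power2_eq_square)
      have "(\<integral>\<^sup>+y. ?w t * indicator {t. 0 < t \<and> ennreal t < G f y} t * ennreal (\<sigma> y) \<partial>lebesgue)
          = (\<integral>\<^sup>+y. ?w t * (ennreal (\<sigma> y) * indicator {y. ennreal t < G f y} y) \<partial>lebesgue)"
        using True by (intro nn_integral_cong) (auto simp: indicator_def)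
      also have "\<dots> = ?v t * (ennreal t * emeasure S {y. ennreal t < G f y})"
      proof -
        have "(\<integral>\<^sup>+y. ?w t * (ennreal (\<sigma> y) * indicator {y. ennreal t < G f y} y) \<partial>lebesgue)
            = ?w t * (\<integral>\<^sup>+y. ennreal (\<sigma> y) * indicator {y. ennreal t < G f y} y \<partial>lebesgue)"
          by (rule nn_integral_cmult) measurable
        also have "\<dots> = ?w t * emeasure S {y. ennreal t < G f y}"
          using G_sets by (simp add: emeasure_S)
        also have "\<dots> = ?v t * (ennreal t * emeasure S {y. ennreal t < G f y})"
          unfolding wv by (rule mult.assoc)
        finally show ?thesis .
      qed
      also have "\<dots> \<le> ?v t * (?c * (\<integral>\<^sup>+x. f x * indicator {x. ennreal (t / (2 * N) * \<sigma> x) < f x} x \<partial>lebesgue))"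
        by (intro mult_left_mono G_weak_type f True) auto
      also have "\<dots> = (\<integral>\<^sup>+x. ?c * (?v t * (f x * indicator {x. ennreal (t / (2 * N) * \<sigma> x) < f x} x)) \<partial>lebesgue)"
      proof -
        have "(\<integral>\<^sup>+x. ?c * (?v t * (f x * indicator {x. ennreal (t / (2 * N) * \<sigma> x) < f x} x)) \<partial>lebesgue)
            = ?c * (?v t * (\<integral>\<^sup>+x. f x * indicator {x. ennreal (t / (2 * N) * \<sigma> x) < f x} x \<partial>lebesgue))"
          by (rule nn_integral_cmult2) measurable
        then show ?thesis by (simp only: mult.left_commute[of ?c])
      qed
      also have "\<dots> = (\<integral>\<^sup>+x. ?c * (?v t * (indicator {t. 0 < t \<and> ennreal (t / (2 * N) * \<sigma> x) < f x} t * f x)) \<partial>lebesgue)"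
        using True by (intro nn_integral_cong) (auto simp: indicator_def)
      finally show ?thesis .
    qed simp
  qed
  also have "\<dots> = (\<integral>\<^sup>+x. (\<integral>\<^sup>+t. ?c * (?v t * (indicator {t. 0 < t \<and> ennreal (t / (2 * N) * \<sigma> x) < f x} t * f x)) \<partial>lborel) \<partial>lebesgue)"
    by (rule P.Fubini'[symmetric]) measurable
  also have "\<dots> \<le> (\<integral>\<^sup>+x. ennreal (2 * N\<^sup>2 * (p / (p - 1)) * (2 * N) powr (p - 1)) * (ennpowr (f x) p * ennreal (\<omega> x)) \<partial>lebesgue)"
  proof (rule nn_integral_mono_AE, use pos in eventually_elim)
    case (elim x)
    show "(\<integral>\<^sup>+t. ?c * (?v t * (indicator {t. 0 < t \<and> ennreal (t / (2 * N) * \<sigma> x) < f x} t * f x)) \<partial>lborel)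
      \<le> ennreal (2 * N\<^sup>2 * (p / (p - 1)) * (2 * N) powr (p - 1)) * (ennpowr (f x) p * ennreal (\<omega> x))"
    proof (cases "f x")
      case top
      then show ?thesis
        using N_pos p elim by (simp add: ennpowr_def ennreal_mult_top ennreal_top_mult)
    next
      case (real b)
      have "\<sigma> x powr (p - 1) = \<omega> x powr (- 1 / (p - 1) * (p - 1))"
        by (simp only: dual dual_weight_def powr_powr)
      also have "\<dots> = inverse (\<omega> x)"
        using elim p by (simp add: powr_minus)
      finally have sx: "0 < \<sigma> x" "\<sigma> x powr (p - 1) = inverse (\<omega> x)"
        using elim by (auto simp: dual dual_weight_def)
      let ?d = "2 * N * b / \<sigma> x"
      have d: "0 \<le> ?d" using real N_pos sx by simp
      have set: "{t. 0 < t \<and> ennreal (t / (2 * N) * \<sigma> x) < f x} = {t. 0 < t \<and> t < ?d}"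
        using real N_pos sx by (auto simp: ennreal_less_iff field_simps)
      have "(\<integral>\<^sup>+t. ?c * (?v t * (indicator {t. 0 < t \<and> t < ?d} t * f x)) \<partial>lborel)
        = (\<integral>\<^sup>+t. ?c * f x * ennreal (p / (p - 1)) * (ennreal ((p - 1) * t powr (p - 1 - 1)) * indicator {t. 0 < t \<and> t < ?d} t) \<partial>lborel)"
        using p by (intro nn_integral_cong) (simp only: ennreal_mult' divide_nonneg_pos mult_ac less_imp_le diff_gt_0_iff_gt)
      also have "\<dots> = ?c * f x * ennreal (p / (p - 1)) * ennreal (?d powr (p - 1))"
        using powr_layer_real[of "p - 1" ?d] d p by (subst nn_integral_cmult) auto
      also have "\<dots> = ennreal (2 * N\<^sup>2 * b * (p / (p - 1)) * ?d powr (p - 1))"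
        using real p by (simp add: ennreal_mult'[symmetric])
      also have "2 * N\<^sup>2 * b * (p / (p - 1)) * ?d powr (p - 1) =
          2 * N\<^sup>2 * (p / (p - 1)) * (2 * N) powr (p - 1) * (b powr p * \<omega> x)"
      proof -
        have "?d powr (p - 1) = (2 * N) powr (p - 1) * b powr (p - 1) * \<omega> x"
          using N_pos real sx by (simp add: powr_divide powr_mult) (simp add: divide_inverse)
        moreover have "b * b powr (p - 1) = b powr p"
          using real(1) p powr_add[of b 1 "p - 1"] by (cases "b = 0") auto
        ultimately show ?thesis by (simp add: mult_ac)
      qed
      finally show ?thesis
        unfolding set using real elim p N_pos by (simp add: ennpowr_def ennreal_mult'[symmetric])
    qed
  qed
  also have "\<dots> = ennreal (2 * N\<^sup>2 * (p / (p - 1)) * (2 * N) powr (p - 1)) * (\<integral>\<^sup>+x. ennpowr (f x) p * ennreal (\<omega> x) \<partial>lebesgue)"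
    by (rule nn_integral_cmult) measurable
  finally show ?thesis .
qed

end

section \<open>Dyadic bounds for the Riesz kernel\<close>

lemma side_Suc: "side \<rho> (Suc k) = side \<rho> k / 2"
  by (simp add: side_def)

lemma side_0: "side \<rho> 0 = \<rho>"
  by (simp add: side_def)

lemma side_between:
  assumes "0 < d" "d < \<rho>"
  obtains k where "d < side \<rho> k" "side \<rho> k \<le> 2 * d"
proof -
  obtain m where "\<rho> / d < 2 ^ m" using real_arch_pow[of 2] by auto
  then have m: "side \<rho> m \<le> d" using assms by (simp add: side_def field_simps)
  have "\<exists>k. d < side \<rho> k \<and> side \<rho> (Suc k) \<le> d"
  proof (rule ccontr)
    assume "\<not> ?thesis"
    then have "d < side \<rho> k" for k
      by (induction k) (use assms side_0 not_le in auto)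
    then show False using m not_le by blast
  qed
  then show ?thesis using that by (auto simp: side_Suc)
qed

text \<open>The summands grow by the factor \<open>2 powr \<beta>\<close> from one generation to the
  next, so the last nonzero one dominates as in a geometric series. Its side still exceeds
  \<open>d\<close>, whence the power of \<open>d\<close>.\<close>

lemma sum_side_le:
  assumes \<rho>: "0 < \<rho>" and d: "0 < d" and \<beta>: "0 < \<beta>"
  shows "(\<Sum>k\<le>M. if d < side \<rho> k then side \<rho> k powr - \<beta> else 0) \<le> 1 / (1 - 2 powr - \<beta>) * d powr - \<beta>"
proof -
  let ?q = "2 powr - \<beta>"
  have q: "0 < ?q" "?q < 1" using \<beta> by (auto simp: powr_minus_divide)
  have geo: "1 / (1 - r) * (r * s) + s = 1 / (1 - r) * s" if "r < 1" for r s :: real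
    using that by (simp add: field_simps)
  have full: "(\<Sum>k\<le>M. side \<rho> k powr - \<beta>) \<le> 1 / (1 - ?q) * side \<rho> M powr - \<beta>" for M
  proof (induction M)
    case 0
    have "1 \<le> 1 / (1 - ?q)" using q by (simp add: field_simps)
    then show ?case
      using mult_right_mono[of 1 "1 / (1 - ?q)" "side \<rho> 0 powr - \<beta>"] by simp
  next
    case (Suc M)
    have s: "side \<rho> M powr - \<beta> = ?q * side \<rho> (Suc M) powr - \<beta>"
      using powr_mult[of 2 "side \<rho> (Suc M)" "- \<beta>"] side_pos[OF \<rho>, of "Suc M"] by (simp add: side_Suc)
    have "(\<Sum>k\<le>Suc M. side \<rho> k powr - \<beta>) \<le> 1 / (1 - ?q) * (?q * side \<rho> (Suc M) powr - \<beta>) + side \<rho> (Suc M) powr - \<beta>"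
      using Suc s by simp
    also have "\<dots> = 1 / (1 - ?q) * side \<rho> (Suc M) powr - \<beta>"
      using geo q by simp
    finally show ?case .
  qed
  show ?thesis
  proof (induction M)
    case (Suc M)
    show ?case
    proof (cases "d < side \<rho> (Suc M)")
      case True
      have "(\<Sum>k\<le>Suc M. if d < side \<rho> k then side \<rho> k powr - \<beta> else 0) \<le> (\<Sum>k\<le>Suc M. side \<rho> k powr - \<beta>)"
        by (intro sum_mono) auto
      also note full[of "Suc M"]
      also have "1 / (1 - ?q) * side \<rho> (Suc M) powr - \<beta> \<le> 1 / (1 - ?q) * d powr - \<beta>"
        using True d \<beta> q by (intro mult_left_mono powr_mono2') auto
      finally show ?thesis .
    next
      case False
      then show ?thesis using Suc by simp
    qed
  next
    case 0
    show ?case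
    proof (cases "d < side \<rho> 0")
      case True
      note full[of 0]
      also have "1 / (1 - ?q) * side \<rho> 0 powr - \<beta> \<le> 1 / (1 - ?q) * d powr - \<beta>"
        using True d \<beta> q by (intro mult_left_mono powr_mono2') auto
      finally show ?thesis using True by simp
    qed (use q in auto)
  qed
qed

text \<open>Partial sums increase, so the omitted terms form an initial segment, and their sum is a
  partial sum not exceeding \<open>h\<close>.\<close>

lemma sum_above_threshold:
  fixes a :: "nat \<Rightarrow> real"
  assumes "\<And>k. 0 \<le> a k" "0 \<le> h"
  shows "(\<Sum>k\<le>M. a k) - h \<le> (\<Sum>m\<le>M. if h < (\<Sum>k\<le>m. a k) then a m else 0)"
proof (induction M)
  case (Suc M)
  have "0 \<le> (\<Sum>m\<le>M. if h < (\<Sum>k\<le>m. a k) then a m else 0)"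
    using assms by (intro sum_nonneg) auto
  then show ?case using Suc assms(1)[of "Suc M"] by auto
next
  case 0
  show ?case using assms(2) by (cases "h < a 0") simp_all
qed

lemma suminf_split_ennreal:
  fixes f :: "nat \<Rightarrow> ennreal"
  shows "(\<Sum>k. f k) = (\<Sum>k\<le>m. f k) + (\<Sum>i. f (i + Suc m))"
proof (induction m)
  case 0
  have "f sums ((\<Sum>i. f (Suc i)) + f 0)"
    by (intro sums_Suc summable_sums) auto
  then show ?case by (simp add: sums_iff add.commute)
next
  case (Suc m)
  have "(\<lambda>i. f (i + Suc m)) sums ((\<Sum>i. f (Suc i + Suc m)) + f (0 + Suc m))"
    by (intro sums_Suc summable_sums) auto
  then show ?case using Suc by (simp add: sums_iff add_ac)
qed

lemma ennreal_divide_antimono: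
  fixes a b c :: ennreal
  assumes "b \<le> c"
  shows "a / c \<le> a / b"
proof -
  have "inverse c \<le> inverse b"
  proof (cases "b = 0 \<or> c = top")
    case False
    then obtain b' c' where bc: "b = ennreal b'" "c = ennreal c'" "0 < b'" "b' \<le> c'"
      using assms by (cases b; cases c) (auto simp: top_unique)
    then have "inverse c = ennreal (inverse c')" "inverse b = ennreal (inverse b')"
      by (auto intro!: inverse_ennreal)
    then show ?thesis using bc by (simp add: ennreal_leI le_imp_inverse_le)
  qed auto
  then show ?thesis
    unfolding divide_ennreal_def by (rule mult_left_mono) simp
qed

lemma measurable_infnorm [measurable]: "infnorm \<in> borel_measurable (borel :: (real^'n) measure)"
  by (intro borel_measurable_continuous_onI continuous_at_imp_continuous_on ballI continuous_infnorm continuous_ident)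

section \<open>The test functions\<close>

text \<open>Finite energy is assumed because the final estimate is trivial otherwise. It makes every
  term of the dyadic sum finite, although the full sum may still be infinite.\<close>

locale capacity_setup = A_infty_weight \<sigma> \<rho> K for \<sigma> :: "real^'n \<Rightarrow> real" and \<rho> K +
  fixes \<alpha> p :: real and \<omega> :: "real^'n \<Rightarrow> real" and \<phi> :: "real^'n \<Rightarrow> ennreal"
  assumes \<alpha>: "0 < \<alpha>" "\<alpha> < real CARD('n)" and p: "1 < p"
    and \<omega>: "weight \<omega>" and dual: "\<sigma> = dual_weight p \<omega>"
    and \<phi> [measurable]: "\<phi> \<in> borel_measurable lebesgue"
    and energy: "(\<integral>\<^sup>+x. ennpowr (\<phi> x) p * ennreal (\<omega> x) \<partial>lebesgue) < \<infinity>"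
begin

section \<open>Dyadic sums and the truncated potential\<close>

definition \<beta> :: real where "\<beta> = real CARD('n) - \<alpha>"

lemma \<beta>: "0 < \<beta>" using \<alpha> by (simp add: \<beta>_def)

definition a :: "nat \<Rightarrow> real^'n \<Rightarrow> ennreal" where
  "a k x = ennreal (side \<rho> k powr - \<beta>) * emeasure (\<nu> \<phi>) (nbhd \<rho> k (idx \<rho> k x))"

definition V :: "real^'n \<Rightarrow> ennreal" where "V x = (\<Sum>k. a k x)"

text \<open>This is the partial sum \<open>V_Q\<close> of the overview, with \<open>Q\<close> the
  cell of generation \<open>m\<close> around \<open>x\<close>; by \<open>Vp_cong\<close> it depends
  on that cell only.\<close>

definition Vp :: "nat \<Rightarrow> real^'n \<Rightarrow> ennreal" where "Vp m x = (\<Sum>k\<le>m. a k x)"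

lemma measurable_\<omega> [measurable]: "\<omega> \<in> borel_measurable lebesgue"
  using \<omega> by (rule weight_measurable)

lemma AE_\<omega>_pos: "AE x in lebesgue. 0 < \<omega> x"
  using \<omega> by (simp add: weight_def)

lemma \<sigma>_pos: "0 < \<omega> x \<Longrightarrow> 0 < \<sigma> x"
  by (simp add: dual dual_weight_def)

lemma \<sigma>_powr: "0 < \<omega> x \<Longrightarrow> \<sigma> x powr (p - 1) * \<omega> x = 1"
proof -
  assume x: "0 < \<omega> x"
  have "\<sigma> x powr (p - 1) = \<omega> x powr (- 1 / (p - 1) * (p - 1))"
    by (simp only: dual dual_weight_def powr_powr)
  also have "\<dots> = inverse (\<omega> x)"
    using x p by (simp add: powr_minus)
  finally show ?thesis using x by simp
qed

lemma measurable_a [measurable]: "a k \<in> borel_measurable lebesgue"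
  unfolding a_def
  by (intro measurable_idx_compose[of "\<lambda>i. ennreal (side \<rho> k powr - \<beta>) * emeasure (\<nu> \<phi>) (nbhd \<rho> k i)"])

lemma measurable_V [measurable]: "V \<in> borel_measurable lebesgue"
  unfolding V_def by measurable

text \<open>In place of Hoelder's inequality a pointwise bound suffices: almost everywhere \<phi> is
  at most \<open>\<phi>^p * \<omega> + \<sigma>\<close>. Indeed, where \<phi> exceeds \<sigma>, the
  product \<open>\<phi>^(p-1) * \<omega>\<close> is at least
  \<open>\<sigma>^(p-1) * \<omega> = 1\<close>. Both summands have finite integral over the
  neighbourhood.\<close>

lemma \<nu>_nbhd_finite: "emeasure (\<nu> \<phi>) (nbhd \<rho> k i) < \<infinity>"
proof -
  let ?E = "nbhd \<rho> k i"
  have "emeasure (\<nu> \<phi>) ?E = (\<integral>\<^sup>+x\<in>?E. \<phi> x \<partial>lebesgue)"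
    using \<rho> by (simp add: emeasure_\<nu>)
  also have "\<dots> \<le> (\<integral>\<^sup>+x. ennpowr (\<phi> x) p * ennreal (\<omega> x) + ennreal (\<sigma> x) * indicator ?E x \<partial>lebesgue)"
  proof (rule nn_integral_mono_AE, use AE_\<omega>_pos in eventually_elim)
    case (elim x)
    have "\<phi> x \<le> ennpowr (\<phi> x) p * ennreal (\<omega> x) + ennreal (\<sigma> x)"
    proof (cases "\<phi> x")
      case top
      then show ?thesis using elim by (simp add: ennpowr_def ennreal_top_mult)
    next
      case (real b)
      have "b \<le> b powr p * \<omega> x + \<sigma> x"
      proof (cases "b \<le> \<sigma> x")
        case True
        then show ?thesis using elim by (simp add: add_increasing)
      next
        case False
        then have "\<sigma> x powr (p - 1) \<le> b powr (p - 1)"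
          using \<sigma>_pos[OF elim] p by (intro powr_mono2) auto
        then have "1 \<le> b powr (p - 1) * \<omega> x"
          using \<sigma>_powr[OF elim] elim mult_right_mono[of "\<sigma> x powr (p - 1)" "b powr (p - 1)" "\<omega> x"] by simp
        then have "b * 1 \<le> b * (b powr (p - 1) * \<omega> x)"
          using real by (intro mult_left_mono) auto
        moreover have "b * b powr (p - 1) = b powr p"
          using False \<sigma>_pos[OF elim] powr_add[of b 1 "p - 1"] by simp
        ultimately show ?thesis using \<sigma>_pos[OF elim] by (simp add: mult.assoc[symmetric])
      qed
      then show ?thesis
        using real elim \<sigma>_pos[OF elim]
        by (simp add: ennpowr_def ennreal_mult'[symmetric] ennreal_plus[symmetric] del: ennreal_plus)
    qed
    then show ?case by (auto simp: indicator_def)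
  qed
  also have "\<dots> = (\<integral>\<^sup>+x. ennpowr (\<phi> x) p * ennreal (\<omega> x) \<partial>lebesgue) + emeasure S ?E"
    using \<rho> by (subst nn_integral_add) (auto simp: emeasure_S)
  also have "\<dots> < \<infinity>"
    using energy S_nbhd[of k i] S_cell_finite[of k i]
    by (auto simp: ennreal_mult_less_top intro: le_less_trans)
  finally show ?thesis .
qed

lemma a_finite: "a k x < \<infinity>"
  using \<nu>_nbhd_finite by (simp add: a_def ennreal_mult_less_top)

lemma Vp_finite: "Vp m x < \<infinity>"
  using a_finite by (simp add: Vp_def)

lemma Vp_le_V: "Vp m x \<le> V x"
  unfolding Vp_def V_def by (rule sum_le_suminf) auto

lemma Vp_cong:
  assumes "idx \<rho> m x = idx \<rho> m y"
  shows "Vp m x = Vp m y"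
  unfolding Vp_def a_def using idx_eq_le[OF _ assms] by (intro sum.cong) auto

text \<open>A single generation dominates the kernel: if the side is larger than the distance of the
  two points but at most twice it, then \<open>y\<close> lies in the neighbourhood of the cell of
  \<open>x\<close>, and the powers differ by at most \<open>2 powr \<beta>\<close>.\<close>

lemma riesz_potential_le_V: "riesz_potential \<alpha> \<rho> \<phi> x \<le> ennreal (2 powr \<beta>) * V x"
proof -
  let ?f = "\<lambda>k y. ennreal (side \<rho> k powr - \<beta>) * (\<phi> y * indicator (nbhd \<rho> k (idx \<rho> k x)) y)"
  have "riesz_kernel \<alpha> \<rho> (x - y) * \<phi> y \<le> ennreal (2 powr \<beta>) * (\<Sum>k. ?f k y)" for y
  proof (cases "0 < infnorm (x - y) \<and> infnorm (x - y) < \<rho>")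
    \<comment> \<open>This covers \<open>y = x\<close> as well, where \<open>0 powr\<close> gives
      the kernel the value 0.\<close>
    case False
    then have "riesz_kernel \<alpha> \<rho> (x - y) = 0"
      using infnorm_pos_le[of "x - y"] by (auto simp: riesz_kernel_def indicator_def)
    then show ?thesis by simp
  next
    case True
    then obtain k where k: "infnorm (x - y) < side \<rho> k" "side \<rho> k \<le> 2 * infnorm (x - y)"
      using side_between[of "infnorm (x - y)" \<rho>] by blast
    have y: "y \<in> nbhd \<rho> k (idx \<rho> k x)"
      using infnorm_imp_near[OF \<rho> k(1)] near_sym by (auto simp: nbhd_def)
    have "infnorm (x - y) powr - \<beta> = 2 powr \<beta> * (2 * infnorm (x - y)) powr - \<beta>"
      using True by (simp add: powr_mult powr_minus)
    also have "\<dots> \<le> 2 powr \<beta> * side \<rho> k powr - \<beta>"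
      using \<beta> k side_pos[OF \<rho>] by (intro mult_left_mono powr_mono2') auto
    finally have "riesz_kernel \<alpha> \<rho> (x - y) \<le> ennreal (2 powr \<beta> * side \<rho> k powr - \<beta>)"
      using True by (simp add: riesz_kernel_def \<beta>_def ennreal_leI)
    then have "riesz_kernel \<alpha> \<rho> (x - y) * \<phi> y \<le> ennreal (2 powr \<beta>) * ?f k y"
      using y by (simp add: ennreal_mult mult.assoc mult_right_mono flip: mult.assoc)
    also have "\<dots> \<le> ennreal (2 powr \<beta>) * (\<Sum>k. ?f k y)"
      using sum_le_suminf[of "\<lambda>k. ?f k y" "{k}"] by (intro mult_left_mono) auto
    finally show ?thesis .
  qed
  then have "riesz_potential \<alpha> \<rho> \<phi> x \<le> (\<integral>\<^sup>+y. ennreal (2 powr \<beta>) * (\<Sum>k. ?f k y) \<partial>lebesgue)"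
    unfolding riesz_potential_def by (intro nn_integral_mono)
  also have "\<dots> = ennreal (2 powr \<beta>) * (\<Sum>k. \<integral>\<^sup>+y. ?f k y \<partial>lebesgue)"
    using \<rho> by (subst nn_integral_cmult) (auto intro!: arg_cong2[where f = times] nn_integral_suminf)
  also have "\<dots> = ennreal (2 powr \<beta>) * V x"
    using \<rho> by (simp add: V_def a_def nn_integral_cmult emeasure_\<nu>)
  finally show ?thesis .
qed

definition L :: real where "L = 1 / (1 - 2 powr - \<beta>)"

lemma L_pos: "0 < L"
  using \<beta> by (auto simp: L_def powr_minus_divide)

text \<open>Points in a common cell are closer than its side. Hence only sides above their distance
  contribute to the sum at \<open>y\<close>, and \<open>sum_side_le\<close> bounds these by
  \<open>L\<close> times the kernel.\<close>

lemma riesz_potential_ge: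
  fixes f :: "real^'n \<Rightarrow> ennreal"
  assumes [measurable]: "f \<in> borel_measurable lebesgue"
  shows "(\<Sum>k\<le>M. ennreal (side \<rho> k powr - \<beta>) * (\<integral>\<^sup>+y\<in>cell \<rho> k (idx \<rho> k x). f y \<partial>lebesgue))
    \<le> ennreal L * riesz_potential \<alpha> \<rho> f x"
proof -
  let ?c = "\<lambda>k. cell \<rho> k (idx \<rho> k x)"
  have "(\<Sum>k\<le>M. ennreal (side \<rho> k powr - \<beta>) * (\<integral>\<^sup>+y\<in>?c k. f y \<partial>lebesgue))
    = (\<integral>\<^sup>+y. (\<Sum>k\<le>M. ennreal (side \<rho> k powr - \<beta>) * (f y * indicator (?c k) y)) \<partial>lebesgue)"
    using \<rho> by (simp add: nn_integral_sum nn_integral_cmult)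
  also have "\<dots> \<le> (\<integral>\<^sup>+y. ennreal L * (riesz_kernel \<alpha> \<rho> (x - y) * f y) \<partial>lebesgue)"
  proof (rule nn_integral_mono_AE)
    \<comment> \<open>At \<open>y = x\<close> the kernel is 0 while the sum need not vanish, so the
      pointwise bound holds only off the diagonal.\<close>
    have "AE y in lebesgue. y \<noteq> x"
      using AE_lborel_singleton AE_completion by blast
    then show "AE y in lebesgue. (\<Sum>k\<le>M. ennreal (side \<rho> k powr - \<beta>) * (f y * indicator (?c k) y))
        \<le> ennreal L * (riesz_kernel \<alpha> \<rho> (x - y) * f y)"
    proof eventually_elim
      case (elim y)
      let ?d = "infnorm (x - y)"
      have d: "0 < ?d" using elim by (simp add: infnorm_pos_lt)
      have "(\<Sum>k\<le>M. ennreal (side \<rho> k powr - \<beta>) * indicator (?c k) y)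
          \<le> (\<Sum>k\<le>M. ennreal (if ?d < side \<rho> k then side \<rho> k powr - \<beta> else 0))"
        using idx_eq_imp_infnorm[OF \<rho>, of _ x y]
        by (intro sum_mono) (auto simp: indicator_def cell_def)
      also have "\<dots> = ennreal (\<Sum>k\<le>M. if ?d < side \<rho> k then side \<rho> k powr - \<beta> else 0)"
        by (intro sum_ennreal) auto
      also have "\<dots> \<le> ennreal L * riesz_kernel \<alpha> \<rho> (x - y)"
      proof (cases "?d < \<rho>")
        case True
        then have "riesz_kernel \<alpha> \<rho> (x - y) = ennreal (?d powr - \<beta>)"
          by (simp add: riesz_kernel_def \<beta>_def)
        then show ?thesis
          using sum_side_le[OF \<rho> d \<beta>, of M] L_pos
          by (simp add: L_def[symmetric] ennreal_mult'[symmetric] ennreal_leI)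
      next
        case False
        then have "\<not> ?d < side \<rho> k" for k using side_le[OF \<rho>, of k] by linarith
        then show ?thesis by simp
      qed
      finally have "(\<Sum>k\<le>M. ennreal (side \<rho> k powr - \<beta>) * indicator (?c k) y) * f y \<le> ennreal L * riesz_kernel \<alpha> \<rho> (x - y) * f y"
        by (rule mult_right_mono) simp
      moreover have "(\<Sum>k\<le>M. ennreal (side \<rho> k powr - \<beta>) * (f y * indicator (?c k) y)) =
          (\<Sum>k\<le>M. ennreal (side \<rho> k powr - \<beta>) * indicator (?c k) y) * f y"
        unfolding sum_distrib_right by (intro sum.cong) (auto simp: mult_ac)
      ultimately show ?case by (simp only: mult.assoc)
    qed
  qed
  also have "\<dots> = ennreal L * riesz_potential \<alpha> \<rho> f x"
    unfolding riesz_potential_def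
  proof (rule nn_integral_cmult)
    have "(\<lambda>y. riesz_kernel \<alpha> \<rho> (x - y)) \<in> borel_measurable borel"
      unfolding riesz_kernel_def by measurable
    then show "(\<lambda>y. riesz_kernel \<alpha> \<rho> (x - y) * f y) \<in> borel_measurable lebesgue"
      by (intro borel_measurable_times_ennreal assms measurable_completion) simp
  qed
  finally show ?thesis .
qed

section \<open>Lebesgue averages of the dyadic sum over cells\<close>

definition C2 :: real where "C2 = 3 ^ CARD('n) / (2 powr \<alpha> - 1)"

lemma C2_pos: "0 < C2"
  using \<alpha> by (simp add: C2_def)

text \<open>Exchange the integrals. For fixed \<open>z\<close> the relevant \<open>y\<close> lie in
  the neighbourhood of the small cell of \<open>z\<close>, of volume \<open>3 ^ CARD('n)\<close>
  times that of the cell. Adjacency passes to the coarser generation, so only \<open>z\<close> near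
  the large cell matter. Side to the power \<open>CARD('n) - \<beta>\<close> is side to the power
  \<alpha>.\<close>

lemma a_average:
  assumes "m \<le> k"
  shows "(\<integral>\<^sup>+y\<in>cell \<rho> m (idx \<rho> m x). a k y \<partial>lebesgue) \<le>
    ennreal (3 ^ CARD('n) * side \<rho> k powr \<alpha>) * emeasure (\<nu> \<phi>) (nbhd \<rho> m (idx \<rho> m x))"
proof -
  interpret Lb: sigma_finite_measure "lebesgue :: (real^'n) measure" by (rule sigma_finite_lebesgue)
  interpret P: pair_sigma_finite "lebesgue :: (real^'n) measure" "lebesgue :: (real^'n) measure" ..
  let ?c = "cell \<rho> m (idx \<rho> m x)" and ?N = "nbhd \<rho> m (idx \<rho> m x)" and ?s = "ennreal (side \<rho> k powr - \<beta>)"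
  let ?g = "\<lambda>z y. ?s * (\<phi> z * indicator (nbhd \<rho> k (idx \<rho> k y)) z * indicator ?c y)"
  have [measurable]: "?c \<in> sets lebesgue" "?N \<in> sets lebesgue" using \<rho> by auto
  \<comment> \<open>Joint measurability holds because the index of the second point takes only
    countably many values.\<close>
  have "(\<lambda>q. indicator (nbhd \<rho> k (idx \<rho> k (snd q))) (fst q) :: ennreal) \<in> borel_measurable ((lebesgue :: (real^'n) measure) \<Otimes>\<^sub>M (lebesgue :: (real^'n) measure))"
  proof (rule measurable_compose_countable[where f = "\<lambda>i q. indicator (nbhd \<rho> k i) (fst q)"])
    show "(\<lambda>q. indicator (nbhd \<rho> k i) (fst q) :: ennreal) \<in> borel_measurable ((lebesgue :: (real^'n) measure) \<Otimes>\<^sub>M (lebesgue :: (real^'n) measure))" for i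
      using \<rho> by (intro measurable_compose[OF measurable_fst]) auto
    show "(\<lambda>q. idx \<rho> k (snd q)) \<in> (lebesgue :: (real^'n) measure) \<Otimes>\<^sub>M (lebesgue :: (real^'n) measure) \<rightarrow>\<^sub>M count_space UNIV"
      by (rule measurable_compose[OF measurable_snd measurable_idx[OF \<rho>]])
  qed
  note [measurable] = this
  have "(\<integral>\<^sup>+y\<in>?c. a k y \<partial>lebesgue) = (\<integral>\<^sup>+y. (\<integral>\<^sup>+z. ?g z y \<partial>lebesgue) \<partial>lebesgue)"
  proof (rule nn_integral_cong)
    fix y :: "real^'n"
    have [measurable]: "nbhd \<rho> k (idx \<rho> k y) \<in> sets lebesgue" using \<rho> by simp
    have "(\<integral>\<^sup>+z. ?g z y \<partial>lebesgue) = (\<integral>\<^sup>+z. ?s * (indicator ?c y * (\<phi> z * indicator (nbhd \<rho> k (idx \<rho> k y)) z)) \<partial>lebesgue)"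
      by (simp add: mult_ac)
    also have "\<dots> = ?s * (indicator ?c y * (\<integral>\<^sup>+z. \<phi> z * indicator (nbhd \<rho> k (idx \<rho> k y)) z \<partial>lebesgue))"
      by (rule nn_integral_cmult2) measurable
    also have "\<dots> = a k y * indicator ?c y"
      using \<rho> by (simp add: a_def emeasure_\<nu> mult_ac)
    finally show "a k y * indicator ?c y = (\<integral>\<^sup>+z. ?g z y \<partial>lebesgue)" ..
  qed
  also have "\<dots> = (\<integral>\<^sup>+z. (\<integral>\<^sup>+y. ?g z y \<partial>lebesgue) \<partial>lebesgue)"
    by (rule P.Fubini') measurable
  also have "\<dots> \<le> (\<integral>\<^sup>+z. ?s * ennreal (3 ^ CARD('n) * side \<rho> k ^ CARD('n)) * (\<phi> z * indicator ?N z) \<partial>lebesgue)"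
  proof (rule nn_integral_mono)
    fix z
    have "?g z y \<le> ?s * (\<phi> z * indicator ?N z) * indicator (nbhd \<rho> k (idx \<rho> k z)) y" for y
    proof (cases "z \<in> nbhd \<rho> k (idx \<rho> k y) \<and> y \<in> ?c")
      case True
      then have nz: "near (idx \<rho> k z) (idx \<rho> k y)" by (simp add: nbhd_def)
      have "near (idx \<rho> m z) (idx \<rho> m y)"
        using near_le[OF assms nz] .
      then have "z \<in> ?N" "y \<in> nbhd \<rho> k (idx \<rho> k z)"
        using True nz near_sym by (auto simp: nbhd_def cell_def)
      then show ?thesis using True by simp
    qed auto
    then have "(\<integral>\<^sup>+y. ?g z y \<partial>lebesgue) \<le> (\<integral>\<^sup>+y. ?s * (\<phi> z * indicator ?N z) * indicator (nbhd \<rho> k (idx \<rho> k z)) y \<partial>lebesgue)"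
      by (intro nn_integral_mono)
    also have "\<dots> = ?s * (\<phi> z * indicator ?N z) * ennreal (3 ^ CARD('n) * side \<rho> k ^ CARD('n))"
      using \<rho> by (subst nn_integral_cmult_indicator) (auto simp: emeasure_nbhd)
    finally show "(\<integral>\<^sup>+y. ?g z y \<partial>lebesgue) \<le> ?s * ennreal (3 ^ CARD('n) * side \<rho> k ^ CARD('n)) * (\<phi> z * indicator ?N z)"
      by (simp add: mult_ac)
  qed
  also have "\<dots> = ?s * ennreal (3 ^ CARD('n) * side \<rho> k ^ CARD('n)) * emeasure (\<nu> \<phi>) ?N"
    using \<rho> by (subst nn_integral_cmult) (auto simp: emeasure_\<nu>)
  also have "?s * ennreal (3 ^ CARD('n) * side \<rho> k ^ CARD('n)) = ennreal (3 ^ CARD('n) * side \<rho> k powr \<alpha>)"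
    using side_pos[OF \<rho>, of k]
    by (simp add: ennreal_mult'[symmetric] \<beta>_def powr_diff powr_realpow[symmetric])
  finally show ?thesis .
qed

text \<open>The terms up to generation \<open>m\<close> are constant on the cell and account for the
  summand 1. By \<open>a_average\<close> the finer terms form a geometric series of ratio
  \<open>2 powr - \<alpha>\<close>. Its sum \<open>C2 * side \<rho> m powr \<alpha>\<close>, times
  the mass of the neighbourhood, is the volume of the cell times \<open>C2 * a m x\<close>.\<close>

lemma V_average:
  "(\<integral>\<^sup>+y\<in>cell \<rho> m (idx \<rho> m x). V y \<partial>lebesgue) \<le> ennreal ((1 + C2) * side \<rho> m ^ CARD('n)) * Vp m x"
proof -
  let ?c = "cell \<rho> m (idx \<rho> m x)" and ?n = "CARD('n)" and ?\<mu> = "emeasure (\<nu> \<phi>) (nbhd \<rho> m (idx \<rho> m x))"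
  have [measurable]: "?c \<in> sets lebesgue" using \<rho> by auto
  have s: "0 < side \<rho> m" by (rule side_pos[OF \<rho>])
  have split: "V y = Vp m y + (\<Sum>i. a (i + Suc m) y)" for y
    unfolding V_def Vp_def by (rule suminf_split_ennreal)
  have "(\<integral>\<^sup>+y\<in>?c. V y \<partial>lebesgue) = (\<integral>\<^sup>+y. Vp m x * indicator ?c y + (\<Sum>i. a (i + Suc m) y * indicator ?c y) \<partial>lebesgue)"
    by (intro nn_integral_cong) (auto simp: split indicator_def cell_def dest: Vp_cong)
  also have "\<dots> = Vp m x * ennreal (side \<rho> m ^ ?n) + (\<Sum>i. \<integral>\<^sup>+y\<in>?c. a (i + Suc m) y \<partial>lebesgue)"
  proof -
    have "(\<integral>\<^sup>+y. Vp m x * indicator ?c y + (\<Sum>i. a (i + Suc m) y * indicator ?c y) \<partial>lebesgue)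
      = (\<integral>\<^sup>+y. Vp m x * indicator ?c y \<partial>lebesgue) + (\<integral>\<^sup>+y. (\<Sum>i. a (i + Suc m) y * indicator ?c y) \<partial>lebesgue)"
      by (rule nn_integral_add) measurable
    also have "(\<integral>\<^sup>+y. (\<Sum>i. a (i + Suc m) y * indicator ?c y) \<partial>lebesgue) = (\<Sum>i. \<integral>\<^sup>+y\<in>?c. a (i + Suc m) y \<partial>lebesgue)"
      by (rule nn_integral_suminf) measurable
    finally show ?thesis
      using \<rho> by (simp add: emeasure_cell nn_integral_cmult_indicator)
  qed
  also have "(\<Sum>i. \<integral>\<^sup>+y\<in>?c. a (i + Suc m) y \<partial>lebesgue) \<le> (\<Sum>i. ennreal (3 ^ ?n * side \<rho> (i + Suc m) powr \<alpha>) * ?\<mu>)"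
    by (intro suminf_le a_average) auto
  also have "\<dots> = (\<Sum>i. ennreal (3 ^ ?n * side \<rho> (i + Suc m) powr \<alpha>)) * ?\<mu>"
    by simp
  also have "(\<Sum>i. ennreal (3 ^ ?n * side \<rho> (i + Suc m) powr \<alpha>)) = ennreal (C2 * side \<rho> m powr \<alpha>)"
  proof (rule suminf_ennreal_eq)
    let ?q = "2 powr - \<alpha>"
    have q: "0 < ?q" "?q < 1" using \<alpha> by (auto simp: powr_minus_divide)
    have "3 ^ ?n * side \<rho> (i + Suc m) powr \<alpha> = 3 ^ ?n * side \<rho> m powr \<alpha> * ?q * ?q ^ i" for i
    proof -
      have "side \<rho> (i + Suc m) = side \<rho> m * (inverse 2) ^ Suc i"
        by (simp add: side_def power_add field_simps)
      also have "\<dots> powr \<alpha> = side \<rho> m powr \<alpha> * (inverse 2 powr \<alpha>) ^ Suc i"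
      proof -
        have "(r ^ j) powr \<alpha> = (r powr \<alpha>) ^ j" if "0 < r" for r :: real and j
          using that by (induction j) (simp_all add: powr_mult)
        from this[of "inverse 2" "Suc i"] show ?thesis
          using s by (simp only: powr_mult) simp
      qed
      also have "inverse 2 powr \<alpha> = ?q" by (simp add: powr_minus powr_divide divide_inverse[symmetric] inverse_eq_divide)
      finally show ?thesis by simp
    qed
    moreover have "(\<lambda>i. 3 ^ ?n * side \<rho> m powr \<alpha> * ?q * ?q ^ i) sums (3 ^ ?n * side \<rho> m powr \<alpha> * ?q * (1 / (1 - ?q)))"
      using q by (intro sums_mult geometric_sums) auto
    moreover have "3 ^ ?n * side \<rho> m powr \<alpha> * ?q * (1 / (1 - ?q)) = C2 * side \<rho> m powr \<alpha>"
      using \<alpha> by (simp add: C2_def powr_minus field_simps)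
    ultimately show "(\<lambda>i. 3 ^ ?n * side \<rho> (i + Suc m) powr \<alpha>) sums (C2 * side \<rho> m powr \<alpha>)"
      by (simp only:)
  qed auto
  also have "ennreal (C2 * side \<rho> m powr \<alpha>) * ?\<mu> = ennreal (C2 * side \<rho> m ^ ?n) * a m x"
  proof -
    have "side \<rho> m powr \<alpha> = side \<rho> m ^ ?n * side \<rho> m powr - \<beta>"
      using s by (simp add: powr_realpow[symmetric] powr_add[symmetric] \<beta>_def)
    then show ?thesis
      using C2_pos s by (simp add: a_def ennreal_mult mult.assoc)
  qed
  also have "\<dots> \<le> ennreal (C2 * side \<rho> m ^ ?n) * Vp m x"
    unfolding Vp_def by (intro mult_left_mono member_le_sum) auto
  finally show ?thesis
    using C2_pos s by (simp add: ennreal_mult ring_distribs mult_ac add_mono)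
qed

text \<open>Markov's inequality at twice the bound that \<open>V_average\<close> gives for the mean
  leaves at least half of the cell.\<close>

lemma V_half:
  assumes "0 < Vp m x"
  shows "ennreal (1/2 * side \<rho> m ^ CARD('n)) \<le>
    emeasure lebesgue {y \<in> cell \<rho> m (idx \<rho> m x). V y \<le> ennreal (2 * (1 + C2)) * Vp m x}"
proof -
  let ?c = "cell \<rho> m (idx \<rho> m x)" and ?s = "side \<rho> m ^ CARD('n)"
  have c [measurable]: "?c \<in> sets lebesgue" using \<rho> by auto
  obtain v where v: "Vp m x = ennreal v" "0 < v"
    using Vp_finite[of m x] assms by (cases "Vp m x") auto
  define b where "b = 2 * (1 + C2) * v"
  have b: "0 < b" "ennreal (2 * (1 + C2)) * Vp m x = ennreal b"
    unfolding v(1) b_def using v(2) C2_pos by (simp, intro ennreal_mult'[symmetric]) simp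
  have s: "0 < ?s" using side_pos[OF \<rho>] by simp
  let ?F = "{y \<in> ?c. V y \<le> ennreal b}" and ?G = "{y \<in> ?c. 1 \<le> ennreal (1 / b) * V y}"
  have F: "?F \<in> sets lebesgue" and G: "?G \<in> sets lebesgue"
  proof -
    have "?F = {y \<in> space lebesgue. y \<in> ?c \<and> V y \<le> ennreal b}" "?G = {y \<in> space lebesgue. y \<in> ?c \<and> 1 \<le> ennreal (1 / b) * V y}"
      by auto
    moreover have "{y \<in> space lebesgue. y \<in> ?c \<and> V y \<le> ennreal b} \<in> sets lebesgue"
      "{y \<in> space lebesgue. y \<in> ?c \<and> 1 \<le> ennreal (1 / b) * V y} \<in> sets lebesgue"
      by measurable
    ultimately show "?F \<in> sets lebesgue" "?G \<in> sets lebesgue" by simp_all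
  qed
  have "emeasure lebesgue ?G \<le> ennreal (1 / b) * (\<integral>\<^sup>+y\<in>?c. V y \<partial>lebesgue)"
    by (rule nn_integral_Markov_inequality) auto
  also have "\<dots> \<le> ennreal (1 / b) * (ennreal ((1 + C2) * ?s) * Vp m x)"
    by (intro mult_left_mono V_average) auto
  also have "\<dots> = ennreal (1/2 * ?s)"
  proof -
    have "1 / b * ((1 + C2) * ?s * v) = 1/2 * ?s"
    proof -
      have gen: "1 / (2 * r * v) * (r * ?s * v) = 1/2 * ?s" if "0 < r" for r
        using that v by (simp add: field_simps)
      show ?thesis unfolding b_def by (rule gen) (use C2_pos in simp)
    qed
    then show ?thesis
      using v C2_pos s b by (simp only: v(1)) (simp add: ennreal_mult'[symmetric] del: distrib_left_numeral)
  qed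
  finally have G_le: "emeasure lebesgue ?G \<le> ennreal (1/2 * ?s)" .
  have sub: "?c \<subseteq> ?F \<union> ?G"
  proof
    fix y assume y: "y \<in> ?c"
    have "1 \<le> ennreal (1 / b) * V y" if "ennreal b < V y"
    proof -
      have "1 = ennreal (1 / b) * ennreal b" using b by (simp add: ennreal_mult'[symmetric])
      also have "\<dots> \<le> ennreal (1 / b) * V y" using that by (intro mult_left_mono) auto
      finally show ?thesis .
    qed
    then show "y \<in> ?F \<union> ?G" using y by (cases "V y \<le> ennreal b") (auto simp: not_le)
  qed
  have "ennreal ?s = emeasure lebesgue ?c"
    using \<rho> by (simp add: emeasure_cell)
  also have "\<dots> \<le> emeasure lebesgue (?F \<union> ?G)"
    by (rule emeasure_mono[OF sub sets.Un[OF F G]])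
  also have "\<dots> \<le> emeasure lebesgue ?F + emeasure lebesgue ?G"
    by (rule emeasure_subadditive[OF F G])
  also have "\<dots> \<le> emeasure lebesgue ?F + ennreal (1/2 * ?s)"
    using G_le by (intro add_left_mono)
  also have "\<dots> = ennreal (1/2 * ?s) + emeasure lebesgue ?F"
    by (rule add.commute)
  finally have "ennreal (1/2 * ?s) + ennreal (1/2 * ?s) \<le> ennreal (1/2 * ?s) + emeasure lebesgue ?F"
    using s by (simp add: ennreal_plus[symmetric] del: ennreal_plus)
  then have "ennreal (1/2 * ?s) \<le> emeasure lebesgue ?F"
    by (simp only: ennreal_add_left_cancel_le) simp
  then show ?thesis unfolding b(2) .
qed

section \<open>Competitors for the capacity\<close>

definition C1 :: real where "C1 = 4 * (1 + C2) * B * L"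

lemma C1_pos: "0 < C1"
  using C2_pos B_pos L_pos by (simp add: C1_def)

text \<open>In \<open>C1\<close> the factor \<open>2 * (1 + C2)\<close> compensates for the size of
  \<open>V\<close> on the good half of a cell, \<open>B\<close> for the weight lost there,
  \<open>L\<close> for the kernel, and a last 2 for the levels below half the threshold. The
  indicator removes the points with \<open>V = 0\<close>, and division by an infinite
  \<open>V\<close> gives 0.\<close>

definition test_fun :: "real \<Rightarrow> real^'n \<Rightarrow> ennreal" where
  "test_fun \<tau> y = ennreal C1 * (G \<phi> y / V y * (ennreal (\<sigma> y) * indicator {y. ennreal (\<tau> / 2) < V y} y))"

lemma V_sets: "{y. c < V y} \<in> sets lebesgue"
proof -
  have "{y \<in> space lebesgue. c < V y} \<in> sets lebesgue" by measurable
  then show ?thesis by simp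
qed

lemma measurable_test [measurable]: "test_fun \<tau> \<in> borel_measurable lebesgue"
proof -
  note [measurable] = V_sets[of "ennreal (\<tau> / 2)"]
  show ?thesis unfolding test_fun_def by measurable
qed

text \<open>It suffices to integrate over the good half \<open>F\<close> of the cell. There the
  maximal function is at least the quotient of this cell, \<open>V\<close> is at most a multiple of
  \<open>Vp m x\<close>, and the indicator equals 1 because the partial sum is constant on the cell.
  The mass of \<open>F\<close> is at least that of the cell divided by \<open>B\<close>.\<close>

lemma test_cell:
  assumes \<tau>: "0 < \<tau>" and m: "ennreal (\<tau> / 2) < Vp m x"
  shows "ennreal (C1 / (2 * (1 + C2) * B)) * (a m x / Vp m x)
    \<le> ennreal (side \<rho> m powr - \<beta>) * (\<integral>\<^sup>+y\<in>cell \<rho> m (idx \<rho> m x). test_fun \<tau> y \<partial>lebesgue)"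
proof -
  let ?c = "cell \<rho> m (idx \<rho> m x)" and ?\<mu> = "emeasure (\<nu> \<phi>) (nbhd \<rho> m (idx \<rho> m x))"
  define F where "F = {y \<in> ?c. V y \<le> ennreal (2 * (1 + C2)) * Vp m x}"
  define c where "c = ennreal (2 * (1 + C2)) * Vp m x"
  have F [measurable]: "F \<in> sets lebesgue"
  proof -
    have [measurable]: "?c \<in> sets lebesgue" using \<rho> by simp
    have "{y \<in> space lebesgue. y \<in> ?c \<and> V y \<le> ennreal (2 * (1 + C2)) * Vp m x} \<in> sets lebesgue"
      by measurable
    then show ?thesis by (simp add: F_def)
  qed
  have Fc: "F \<subseteq> ?c" by (auto simp: F_def)
  have pos: "0 < Vp m x" using m by (rule le_less_trans[rotated]) simp
  have half: "emeasure S ?c \<le> ennreal B * emeasure S F"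
    using V_half[OF pos] Fc F by (intro S_half) (auto simp: F_def)
  have "ennreal C1 * (?\<mu> / emeasure S ?c / c) * emeasure S F
      = (\<integral>\<^sup>+y. ennreal C1 * (?\<mu> / emeasure S ?c / c) * (ennreal (\<sigma> y) * indicator F y) \<partial>lebesgue)"
    by (subst nn_integral_cmult) (auto simp: emeasure_S)
  also have "\<dots> \<le> (\<integral>\<^sup>+y\<in>?c. test_fun \<tau> y \<partial>lebesgue)"
  proof (rule nn_integral_mono)
    fix y
    show "ennreal C1 * (?\<mu> / emeasure S ?c / c) * (ennreal (\<sigma> y) * indicator F y) \<le> test_fun \<tau> y * indicator ?c y"
    proof (cases "y \<in> F")
      case True
      then have y: "y \<in> ?c" "V y \<le> c" "idx \<rho> m y = idx \<rho> m x"
        by (auto simp: F_def c_def cell_def)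
      have "ennreal (\<tau> / 2) < V y"
        using m Vp_cong[OF y(3)] Vp_le_V[of m y] by (auto elim: less_le_trans)
      moreover have "?\<mu> / emeasure S ?c \<le> G \<phi> y"
        unfolding G_def y(3)[symmetric] by (rule SUP_upper) simp
      then have "?\<mu> / emeasure S ?c / c \<le> G \<phi> y / V y"
        by (intro order_trans[OF divide_right_mono_ennreal ennreal_divide_antimono] y)
      ultimately show ?thesis
        using True y(1) by (simp add: test_fun_def mult.assoc mult_left_mono mult_right_mono)
    qed simp
  qed
  finally have le: "ennreal C1 * (?\<mu> / emeasure S ?c / c) * emeasure S F \<le> (\<integral>\<^sup>+y\<in>?c. test_fun \<tau> y \<partial>lebesgue)" .
  have "ennreal (C1 / (2 * (1 + C2) * B)) * (?\<mu> / Vp m x) \<le> ennreal C1 * (?\<mu> / emeasure S ?c / c) * emeasure S F"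
  proof -
    \<comment> \<open>All quantities are finite and the denominators positive, so the inequality
      reduces to real arithmetic.\<close>
    obtain \<mu> v where \<mu>: "?\<mu> = ennreal \<mu>" "0 \<le> \<mu>" and v: "Vp m x = ennreal v" "0 < v"
      using \<nu>_nbhd_finite[of m "idx \<rho> m x"] Vp_finite[of m x] pos
      by (cases ?\<mu>; cases "Vp m x") auto
    obtain s where s: "emeasure S ?c = ennreal s" "0 < s"
      using S_cell_pos[of m "idx \<rho> m x"] S_cell_finite[of m "idx \<rho> m x"] by (cases "emeasure S ?c") auto
    have "emeasure S F \<le> emeasure S ?c" using \<rho> Fc by (intro emeasure_mono) auto
    then obtain f where f: "emeasure S F = ennreal f" "0 \<le> f"
      using s by (cases "emeasure S F") (auto simp: top_unique)
    have sf: "s \<le> B * f"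
      using half s f B_pos by (simp add: ennreal_mult'[symmetric])
    have c: "c = ennreal (2 * (1 + C2) * v)" "0 < 2 * (1 + C2) * v"
      unfolding c_def v(1) using C2_pos v by (intro ennreal_mult'[symmetric], simp, simp)
    have "C1 / (2 * (1 + C2) * B) * (\<mu> / v) * (s * B) \<le> C1 / (2 * (1 + C2) * B) * (\<mu> / v) * ((B * f) * B)"
      using sf C1_pos C2_pos B_pos \<mu> v by (intro mult_left_mono mult_right_mono) auto
    then have "C1 / (2 * (1 + C2) * B) * (\<mu> / v) \<le> C1 * (\<mu> / s / (2 * (1 + C2) * v)) * f"
      using C1_pos C2_pos B_pos \<mu> v s by (simp add: divide_simps mult_ac)
    then show ?thesis
      unfolding \<mu>(1) v(1) s(1) f(1) c(1)
      using C1_pos C2_pos B_pos \<mu>(2) v(2) s(2) f(2) c(2)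
      by (simp add: divide_ennreal ennreal_mult'[symmetric] ennreal_leI del: distrib_left_numeral)
  qed
  also note le
  finally have "ennreal (side \<rho> m powr - \<beta>) * (ennreal (C1 / (2 * (1 + C2) * B)) * (?\<mu> / Vp m x))
      \<le> ennreal (side \<rho> m powr - \<beta>) * (\<integral>\<^sup>+y\<in>?c. test_fun \<tau> y \<partial>lebesgue)"
    by (intro mult_left_mono) auto
  then show ?thesis
    by (simp only: a_def divide_ennreal_def mult_ac)
qed

text \<open>Stop at a generation \<open>M\<close> where the partial sum exceeds \<tau>; partial sums
  are finite even if \<open>V\<close> is not. By \<open>test_cell\<close> each generation whose
  partial sum is above \<open>\<tau> / 2\<close> contributes its increment divided by its partial
  sum. Enlarging these denominators to the last partial sum still leaves a total of at least one
  half.\<close>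

lemma test_admissible:
  assumes \<tau>: "0 < \<tau>" and x: "ennreal \<tau> < V x"
  shows "1 \<le> riesz_potential \<alpha> \<rho> (test_fun \<tau>) x"
proof -
  have "(\<lambda>M. Vp M x) \<longlonglongrightarrow> V x"
    unfolding Vp_def V_def by (rule summable_LIMSEQ') simp
  then have "eventually (\<lambda>M. ennreal \<tau> < Vp M x) sequentially"
    using x by (rule order_tendstoD)
  then obtain M where M: "ennreal \<tau> < Vp M x"
    by (auto simp: eventually_sequentially)
  define r where "r k = enn2real (a k x)" for k
  define v where "v m = (\<Sum>k\<le>m. r k)" for m
  define c where "c = C1 / (2 * (1 + C2) * B)"
  have c: "0 < c" using C1_pos C2_pos B_pos by (simp add: c_def)
  have r: "a k x = ennreal (r k)" "0 \<le> r k" for k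
    using a_finite[of k x] by (auto simp: r_def)
  have v: "Vp m x = ennreal (v m)" for m
    unfolding Vp_def v_def using r by (simp add: sum_ennreal)
  have vM: "\<tau> < v M" using M v \<tau> by (simp add: ennreal_less_iff)
  have mono: "v m \<le> v M" if "m \<le> M" for m
    unfolding v_def using that r by (intro sum_mono2) auto
  have "ennreal (c / 2) \<le> ennreal (\<Sum>m\<le>M. if \<tau> / 2 < v m then c * (r m / v m) else 0)"
  proof (rule ennreal_leI)
    \<comment> \<open>The increments kept sum to at least \<open>v M - \<tau> / 2\<close>, which is
      more than half of \<open>v M\<close> since \<open>v M\<close> exceeds \<tau>.\<close>
    have "c / 2 = c / v M * (v M - v M / 2)"
      using vM \<tau> by (simp add: field_simps)
    also have "\<dots> \<le> c / v M * (v M - \<tau> / 2)"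
      using vM \<tau> c by (intro mult_left_mono) auto
    also have "\<dots> \<le> c / v M * (\<Sum>m\<le>M. if \<tau> / 2 < v m then r m else 0)"
      unfolding v_def[of M] using vM \<tau> c r unfolding v_def
      by (intro mult_left_mono sum_above_threshold) auto
    also have "\<dots> = (\<Sum>m\<le>M. if \<tau> / 2 < v m then c * (r m / v M) else 0)"
      unfolding sum_distrib_left by (intro sum.cong) auto
    also have "\<dots> \<le> (\<Sum>m\<le>M. if \<tau> / 2 < v m then c * (r m / v m) else 0)"
    proof (rule sum_mono)
      fix m assume m: "m \<in> {..M}"
      show "(if \<tau> / 2 < v m then c * (r m / v M) else 0) \<le> (if \<tau> / 2 < v m then c * (r m / v m) else 0)"
        using mono[of m] m c r(2)[of m] \<tau> by (auto intro!: divide_left_mono)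
    qed
    finally show "c / 2 \<le> (\<Sum>m\<le>M. if \<tau> / 2 < v m then c * (r m / v m) else 0)" .
  qed
  also have "\<dots> = (\<Sum>m\<le>M. ennreal (if \<tau> / 2 < v m then c * (r m / v m) else 0))"
    using c r \<tau> by (intro sum_ennreal[symmetric]) auto
  also have "\<dots> \<le> (\<Sum>m\<le>M. ennreal (side \<rho> m powr - \<beta>) * (\<integral>\<^sup>+y\<in>cell \<rho> m (idx \<rho> m x). test_fun \<tau> y \<partial>lebesgue))"
  proof (rule sum_mono)
    fix m
    show "ennreal (if \<tau> / 2 < v m then c * (r m / v m) else 0) \<le>
      ennreal (side \<rho> m powr - \<beta>) * (\<integral>\<^sup>+y\<in>cell \<rho> m (idx \<rho> m x). test_fun \<tau> y \<partial>lebesgue)"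
    proof (cases "\<tau> / 2 < v m")
      case True
      then have "ennreal (\<tau> / 2) < Vp m x"
        using \<tau> v by (simp add: ennreal_less_iff)
      from test_cell[OF \<tau> this] show ?thesis
        using True \<tau> c r[of m] unfolding v r c_def[symmetric]
        by (simp add: divide_ennreal ennreal_mult'[symmetric])
    qed simp
  qed
  also have "\<dots> \<le> ennreal L * riesz_potential \<alpha> \<rho> (test_fun \<tau>) x"
    by (rule riesz_potential_ge) measurable
  finally have "ennreal (c / 2) \<le> ennreal L * riesz_potential \<alpha> \<rho> (test_fun \<tau>) x" .
  moreover have "c / 2 = L"
    using C2_pos B_pos by (simp add: c_def C1_def)
  ultimately have "ennreal (1 / L) * ennreal L \<le> ennreal (1 / L) * (ennreal L * riesz_potential \<alpha> \<rho> (test_fun \<tau>) x)"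
    by (intro mult_left_mono) auto
  moreover have "ennreal (1 / L) * ennreal L = 1"
    using L_pos by (simp add: ennreal_mult'[symmetric])
  ultimately show ?thesis by (simp add: mult.assoc[symmetric])
qed

text \<open>At a fixed point the competitor depends on the level only through its indicator, which
  admits \<open>t < 2 * c * V y\<close>. The level integral is thus \<open>(2 * c * V y)^p\<close>,
  which cancels the power of \<open>V\<close> in the denominator, and
  \<open>\<sigma>^p * \<omega> = \<sigma>\<close> leaves the weight \<sigma>.\<close>

lemma test_energy:
  assumes y: "0 < \<omega> y" and c: "0 < c"
  shows "(\<integral>\<^sup>+t. ennpowr (test_fun (t / c) y) p * ennreal (\<omega> y) * indicator {0<..} t * ennreal (p * t powr (p - 1)) \<partial>lborel)
    \<le> ennreal ((2 * c * C1) powr p) * (ennpowr (G \<phi> y) p * ennreal (\<sigma> y))"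
proof -
  have sp: "0 < \<sigma> y" by (rule \<sigma>_pos[OF y])
  have "\<sigma> y powr p = \<sigma> y powr (p - 1) * \<sigma> y"
    using sp powr_add[of "\<sigma> y" "p - 1" 1] by simp
  then have sw: "\<sigma> y powr p * \<omega> y = \<sigma> y"
    using \<sigma>_powr[OF y] by (simp add: mult.commute mult.left_commute)
  show ?thesis
  proof (cases "G \<phi> y = \<infinity> \<or> V y = 0 \<or> V y = \<infinity>")
    \<comment> \<open>If the maximal function is infinite, so is the right-hand side because
      \<sigma> is positive at \<open>y\<close>. In the other two cases the competitor vanishes at
      \<open>y\<close>.\<close>
    case True
    then consider "G \<phi> y = \<infinity>" | "V y = 0" | "V y = \<infinity>" by blast
    then show ?thesis
    proof cases
      case 1
      then show ?thesis using sp c C1_pos by (simp add: ennpowr_def ennreal_top_mult ennreal_mult_top)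
    next
      case 2
      then show ?thesis by (simp add: test_fun_def ennpowr_def)
    next
      case 3
      then show ?thesis by (simp add: test_fun_def ennpowr_def)
    qed
  next
    case False
    then obtain g v where g: "G \<phi> y = ennreal g" "0 \<le> g" and v: "V y = ennreal v" "0 < v"
      by (cases "G \<phi> y"; cases "V y") auto
    have "ennpowr (test_fun (t / c) y) p * ennreal (\<omega> y) * indicator {0<..} t * ennreal (p * t powr (p - 1))
      = ennreal ((C1 * (g / v)) powr p * \<sigma> y) * (ennreal (p * t powr (p - 1)) * indicator {t. 0 < t \<and> t < 2 * c * v} t)" for t
    proof (cases "0 < t \<and> t < 2 * c * v")
      case True
      then have "ennreal (t / c / 2) < V y"
        using v c by (simp add: ennreal_less_iff field_simps)
      then have "test_fun (t / c) y = ennreal (C1 * (g / v) * \<sigma> y)"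
        using g v sp C1_pos by (simp add: test_fun_def divide_ennreal ennreal_mult'[symmetric] mult.assoc)
      moreover have "(C1 * (g / v) * \<sigma> y) powr p * \<omega> y = (C1 * (g / v)) powr p * \<sigma> y"
        using g v sp C1_pos by (subst powr_mult) (simp_all add: mult.assoc sw)
      ultimately show ?thesis
        using True g v sp C1_pos y by (simp add: ennpowr_def ennreal_mult'[symmetric])
    next
      case False
      then have "\<not> (0 < t \<and> ennreal (t / c / 2) < V y)"
        using v c by (auto simp: ennreal_less_iff field_simps)
      then have "t \<le> 0 \<or> test_fun (t / c) y = 0"
        by (auto simp: test_fun_def)
      then show ?thesis using False by (auto simp: ennpowr_def)
    qed
    then have "(\<integral>\<^sup>+t. ennpowr (test_fun (t / c) y) p * ennreal (\<omega> y) * indicator {0<..} t * ennreal (p * t powr (p - 1)) \<partial>lborel)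
      = ennreal ((C1 * (g / v)) powr p * \<sigma> y) * ennreal ((2 * c * v) powr p)"
      using powr_layer_real[of p "2 * c * v"] p c v by (simp add: nn_integral_cmult)
    also have "\<dots> = ennreal ((2 * c * C1) powr p) * (ennpowr (G \<phi> y) p * ennreal (\<sigma> y))"
    proof -
      have "(C1 * (g / v)) powr p * (2 * c * v) powr p = (2 * c * C1) powr p * g powr p"
        using C1_pos c g v by (simp add: powr_mult[symmetric] mult_ac)
      then have "(C1 * (g / v)) powr p * \<sigma> y * (2 * c * v) powr p = (2 * c * C1) powr p * (g powr p * \<sigma> y)"
        by (simp add: mult_ac)
      then show ?thesis
        using g sp by (simp add: ennpowr_def ennreal_mult'[symmetric])
    qed
    finally show ?thesis by simp
  qed
qed

lemma capacity_le_energy: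
  assumes [measurable]: "f \<in> borel_measurable lebesgue" and "\<And>x. x \<in> E \<Longrightarrow> 1 \<le> riesz_potential \<alpha> \<rho> f x"
  shows "riesz_capacity \<alpha> p \<rho> \<omega> E \<le> weighted_energy p \<omega> f"
proof (cases "weighted_energy p \<omega> f < \<infinity>")
  case True
  then show ?thesis
    unfolding riesz_capacity_def using assms by (intro INF_lower) auto
next
  case False
  then have "weighted_energy p \<omega> f = \<infinity>" by (simp add: less_top[symmetric])
  then show ?thesis by simp
qed

text \<open>As the potential is at most \<open>2 powr \<beta>\<close> times \<open>V\<close>, a
  potential above \<open>t\<close> forces \<open>V\<close> above \<open>t / c\<close>, so the
  competitor is taken at the rescaled level. Fubini's theorem then reduces the claim to
  \<open>test_energy\<close> at each point and \<open>G_strong_type\<close>.\<close>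

lemma capacitary_inequality:
  "(\<integral>\<^sup>+t\<in>{0<..}. riesz_capacity \<alpha> p \<rho> \<omega> {x. ennreal t < riesz_potential \<alpha> \<rho> \<phi> x}
      * ennreal (p * t powr (p - 1)) \<partial>lborel)
    \<le> ennreal ((2 * 2 powr \<beta> * C1) powr p * (2 * N\<^sup>2 * (p / (p - 1)) * (2 * N) powr (p - 1)))
      * (\<integral>\<^sup>+x. ennpowr (\<phi> x) p * ennreal (\<omega> x) \<partial>lebesgue)"
proof -
  interpret Lb: sigma_finite_measure "lebesgue :: (real^'n) measure" by (rule sigma_finite_lebesgue)
  interpret P: pair_sigma_finite lborel "lebesgue :: (real^'n) measure" ..
  define c :: real where "c = 2 powr \<beta>"
  have c: "0 < c" by (simp add: c_def)
  let ?g = "\<lambda>t y. ennpowr (test_fun (t / c) y) p * ennreal (\<omega> y) * indicator {0<..} t * ennreal (p * t powr (p - 1))"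
  have "(\<integral>\<^sup>+t\<in>{0<..}. riesz_capacity \<alpha> p \<rho> \<omega> {x. ennreal t < riesz_potential \<alpha> \<rho> \<phi> x}
      * ennreal (p * t powr (p - 1)) \<partial>lborel) \<le> (\<integral>\<^sup>+t. (\<integral>\<^sup>+y. ?g t y \<partial>lebesgue) \<partial>lborel)"
  proof (rule nn_integral_mono)
    fix t :: real
    show "riesz_capacity \<alpha> p \<rho> \<omega> {x. ennreal t < riesz_potential \<alpha> \<rho> \<phi> x} * ennreal (p * t powr (p - 1))
        * indicator {0<..} t \<le> (\<integral>\<^sup>+y. ?g t y \<partial>lebesgue)"
    proof (cases "0 < t")
      case True
      have "riesz_capacity \<alpha> p \<rho> \<omega> {x. ennreal t < riesz_potential \<alpha> \<rho> \<phi> x} \<le> weighted_energy p \<omega> (test_fun (t / c))"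
      proof (rule capacity_le_energy)
        fix x assume "x \<in> {x. ennreal t < riesz_potential \<alpha> \<rho> \<phi> x}"
        then have "ennreal t < ennreal c * V x"
          using riesz_potential_le_V[of x] by (auto simp: c_def elim: less_le_trans)
        have "ennreal (t / c) < V x"
        proof (rule ccontr)
          assume "\<not> ennreal (t / c) < V x"
          then have "ennreal c * V x \<le> ennreal c * ennreal (t / c)"
            by (intro mult_left_mono) auto
          also have "\<dots> = ennreal t"
            using c True by (simp add: ennreal_mult'[symmetric])
          finally show False using \<open>ennreal t < ennreal c * V x\<close> by simp
        qed
        then show "1 \<le> riesz_potential \<alpha> \<rho> (test_fun (t / c)) x"
          using True c by (intro test_admissible) auto
      qed measurable
      then have "riesz_capacity \<alpha> p \<rho> \<omega> {x. ennreal t < riesz_potential \<alpha> \<rho> \<phi> x} * ennreal (p * t powr (p - 1))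
        \<le> weighted_energy p \<omega> (test_fun (t / c)) * ennreal (p * t powr (p - 1))"
        by (rule mult_right_mono) simp
      also have "\<dots> = (\<integral>\<^sup>+y. ?g t y \<partial>lebesgue)"
        using True unfolding weighted_energy_def by (subst nn_integral_multc[symmetric]) auto
      finally show ?thesis using True by simp
    qed simp
  qed
  also have "\<dots> = (\<integral>\<^sup>+y. (\<integral>\<^sup>+t. ?g t y \<partial>lborel) \<partial>lebesgue)"
  proof (rule P.Fubini'[symmetric])
    have "(\<lambda>(t, y). test_fun (t / c) y) \<in> borel_measurable (lborel \<Otimes>\<^sub>M (lebesgue :: (real^'n) measure))"
      unfolding test_fun_def by measurable
    then show "(\<lambda>(t, y). ?g t y) \<in> borel_measurable (lborel \<Otimes>\<^sub>M (lebesgue :: (real^'n) measure))"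
      by measurable
  qed
  also have "\<dots> \<le> (\<integral>\<^sup>+y. ennreal ((2 * c * C1) powr p) * (ennpowr (G \<phi> y) p * ennreal (\<sigma> y)) \<partial>lebesgue)"
    by (rule nn_integral_mono_AE, use AE_\<omega>_pos in eventually_elim) (rule test_energy[OF _ c])
  also have "\<dots> = ennreal ((2 * c * C1) powr p) * (\<integral>\<^sup>+y. ennpowr (G \<phi> y) p * ennreal (\<sigma> y) \<partial>lebesgue)"
    by (rule nn_integral_cmult) measurable
  also have "\<dots> \<le> ennreal ((2 * c * C1) powr p) * (ennreal (2 * N\<^sup>2 * (p / (p - 1)) * (2 * N) powr (p - 1)) *
      (\<integral>\<^sup>+x. ennpowr (\<phi> x) p * ennreal (\<omega> x) \<partial>lebesgue))"
    by (intro mult_left_mono G_strong_type \<phi> p AE_\<omega>_pos dual measurable_\<omega>) simp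
  finally show ?thesis
    by (simp only: c_def mult.assoc[symmetric] ennreal_mult'[symmetric] powr_ge_zero)
qed

end

section \<open>The explicit constant and the theorem\<close>

definition capacitary_const :: "nat \<Rightarrow> real \<Rightarrow> real \<Rightarrow> real \<Rightarrow> real" where
  "capacitary_const n \<alpha> p K =
    (let \<beta> = real n - \<alpha>; N = 3 ^ n * frac_const K ((1 / 2) ^ n);
       C1 = 4 * (1 + 3 ^ n / (2 powr \<alpha> - 1)) * frac_const K (1 / 2) * (1 / (1 - 2 powr - \<beta>))
     in (2 * 2 powr \<beta> * C1) powr p * (2 * N\<^sup>2 * (p / (p - 1)) * (2 * N) powr (p - 1)))"

text \<open>The closed expression involves only the dimension, \<alpha>, \<open>p\<close> and
  \<open>K\<close>, so the constant can be fixed before the radius, the weight and the function are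
  given.\<close>

lemma (in capacity_setup) capacitary_const_eq:
  "capacitary_const CARD('n) \<alpha> p K =
    (2 * 2 powr \<beta> * C1) powr p * (2 * N\<^sup>2 * (p / (p - 1)) * (2 * N) powr (p - 1))"
  by (simp add: capacitary_const_def Let_def \<beta>_def N_def D_def C1_def C2_def B_def L_def)

lemma capacitary_const_pos:
  assumes "0 < \<alpha>" "\<alpha> < real n" "1 < p" "1 \<le> K"
  shows "0 < capacitary_const n \<alpha> p K"
proof -
  have "0 < frac_const K \<theta>" if "0 < \<theta>" for \<theta>
    using assms that by (simp add: frac_const_def)
  then have "0 < frac_const K (1 / 2)" "0 < frac_const K ((1 / 2) ^ n)"
    by simp_all
  moreover have "0 < 3 ^ n / (2 powr \<alpha> - 1)" "0 < 1 - 2 powr - (real n - \<alpha>)"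
    using assms powr_less_mono[of "- (real n - \<alpha>)" 0 2] by simp_all
  ultimately have "0 < 4 * (1 + 3 ^ n / (2 powr \<alpha> - 1)) * frac_const K (1 / 2) * (1 / (1 - 2 powr - (real n - \<alpha>)))"
    "0 < 3 ^ n * frac_const K ((1 / 2) ^ n)"
    by (intro mult_pos_pos divide_pos_pos; simp)+
  then show ?thesis
    using assms unfolding capacitary_const_def Let_def
    by (intro mult_pos_pos) auto
qed

theorem theorem3p9p1:
  fixes \<alpha> p :: real
  assumes "0 < \<alpha>" and "\<alpha> < real CARD('n::finite)" and "1 < p"
  shows "\<exists>C :: ennreal \<Rightarrow> real. (\<forall>K. 0 < C K) \<and>
    (\<forall>\<rho>>0. \<forall>\<omega> :: real^'n \<Rightarrow> real. weight \<omega> \<longrightarrow> dual_weight p \<omega> \<in> A_infty_loc \<longrightarrow>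
      (\<forall>\<phi> \<in> borel_measurable lebesgue.
        (\<integral>\<^sup>+t\<in>{0<..}. riesz_capacity \<alpha> p \<rho> \<omega> {x. ennreal t < riesz_potential \<alpha> \<rho> \<phi> x}
            * ennreal (p * t powr (p - 1)) \<partial>lborel)
        \<le> ennreal (C (A_infty_const (2 * \<rho>) (dual_weight p \<omega>)))
            * (\<integral>\<^sup>+x. ennpowr (\<phi> x) p * ennreal (\<omega> x) \<partial>lebesgue)))"
proof (intro exI[of _ "\<lambda>K. capacitary_const CARD('n) \<alpha> p (max 1 (enn2real K))"] conjI allI impI ballI)
  show "0 < capacitary_const CARD('n) \<alpha> p (max 1 (enn2real K))" for K
    by (rule capacitary_const_pos) (use assms in auto)
next
  fix \<rho> :: real and \<omega> :: "real^'n \<Rightarrow> real" and \<phi> :: "real^'n \<Rightarrow> ennreal"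
  assume \<rho>: "0 < \<rho>" and \<omega>: "weight \<omega>" and A: "dual_weight p \<omega> \<in> A_infty_loc"
    and \<phi>: "\<phi> \<in> borel_measurable lebesgue"
  \<comment> \<open>The maximum provides the bound \<open>1 \<le> K\<close> that the estimates use.
    An infinite constant, which \<open>enn2real\<close> would send to 0, is excluded by
    \<open>A_infty_const_finite\<close>.\<close>
  define K where "K = max 1 (enn2real (A_infty_const (2 * \<rho>) (dual_weight p \<omega>)))"
  have pos: "0 < capacitary_const CARD('n) \<alpha> p K"
    by (rule capacitary_const_pos) (use assms K_def in auto)
  have "A_infty_const (2 * \<rho>) (dual_weight p \<omega>) = ennreal (enn2real (A_infty_const (2 * \<rho>) (dual_weight p \<omega>)))"
    using A_infty_const_finite[OF A] by simp
  also have "\<dots> \<le> ennreal K"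
    by (rule ennreal_leI) (simp add: K_def)
  finally have AK: "A_infty_const (2 * \<rho>) (dual_weight p \<omega>) \<le> ennreal K" .
  have wd: "weight (dual_weight p \<omega>)"
    using A by (simp add: A_infty_loc_def)
  show "(\<integral>\<^sup>+t\<in>{0<..}. riesz_capacity \<alpha> p \<rho> \<omega> {x. ennreal t < riesz_potential \<alpha> \<rho> \<phi> x}
            * ennreal (p * t powr (p - 1)) \<partial>lborel)
        \<le> ennreal (capacitary_const CARD('n) \<alpha> p (max 1 (enn2real (A_infty_const (2 * \<rho>) (dual_weight p \<omega>)))))
            * (\<integral>\<^sup>+x. ennpowr (\<phi> x) p * ennreal (\<omega> x) \<partial>lebesgue)"
  proof (cases "(\<integral>\<^sup>+x. ennpowr (\<phi> x) p * ennreal (\<omega> x) \<partial>lebesgue) < \<infinity>")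
    case True
    interpret capacity_setup "dual_weight p \<omega>" \<rho> K \<alpha> p \<omega> \<phi>
      by unfold_locales (use wd \<rho> AK K_def assms \<omega> \<phi> True in auto)
    show ?thesis
      using capacitary_inequality unfolding K_def[symmetric] capacitary_const_eq .
  next
    \<comment> \<open>Since the constant is positive, infinite energy makes the right-hand side
      infinite.\<close>
    case False
    then show ?thesis
      using pos by (simp add: K_def less_top[symmetric] ennreal_mult_top)
  qed
qed

end
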